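(* Let $(\mathbb{H}, d_{cc})$ be the subRiemannian Heisenberg group. There exists a distance $d$ on $\mathbb{H}$ such that (1) $d\le d_{cc}$; (2) $(\mathbb{H},d)$ is Ahlfors $4$-regular; (3) if $A\subseteq\mathbb{H}$ is a subset with $\mathcal{H}^4_{cc}(A)>0$, then $d$ and $d_{cc}$ are not biLipschitz equivalent on $A$.
   Context: $\mathbb{H}$ is $\mathbb{R}^3$ with the group law $p\cdot q = (x_p+x_q,\, y_p+y_q,\, z_p+z_q+\tfrac12(x_py_q-y_px_q))$. The Carnot-Carathéodory (subRiemannian) distance $d_{cc}$ is the left-invariant distance for which $d_{cc}(p,q)$ is the infimum of lengths of absolutely continuous curves from $p$ to $q$ that are a.e. tangent to the span of the left-invariant vector fields $X=\partial_x-\frac y2\partial_z$, $Y=\partial_y+\frac x2\partial_z$, the length being computed by declaring $X,Y$ orthonormal. A distance means a metric on the set (no relation to the topology is assumed). $\mathcal{H}^4_{cc}$ is the Hausdorff $4$-measure of $(\mathbb{H},d_{cc})$. A metric space $(X,d)$ is Ahlfors $Q$-regular if there is $C\ge1$ with $\frac1C r^Q\le \mathcal{H}^Q_d(B_d(x,r))\le C r^Q$ for all $x\in X$ and $0<r<\frac{\operatorname{diam}X}{2}$, where $\mathcal{H}^Q_d$ is Hausdorff $Q$-measure with respect to $d$. Two distances $d,\rho$ are biLipschitz equivalent on $A$ if there is $L\ge1$ with $\frac1L\rho(p,q)\le d(p,q)\le L\rho(p,q)$ for all $p,q\in A$. *)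

theory Defs
  imports "HOL-Analysis.Analysis"
begin

section \<open>Distances, Hausdorff measure and Ahlfors regularity\<close>

text \<open>
  A distance on a set \<open>M\<close> is a function satisfying the predicate \<^term>\<open>Metric_space M\<close>.
  The notions below take the distance as an explicit argument, because several distances on the
  same type, unrelated to its topology, are compared.
\<close>

definition ediam :: "('a \<Rightarrow> 'a \<Rightarrow> real) \<Rightarrow> 'a set \<Rightarrow> ennreal" where
  "ediam d S = (SUP x\<in>S. SUP y\<in>S. ennreal (d x y))"

text \<open>
  Hausdorff \<open>s\<close>-measure of \<open>A \<subseteq> M\<close> for \<open>s > 0\<close>, defined on all subsets as an outer measure,
  without a normalising constant. Since \<open>0 powr s = 0\<close>, sets of diameter 0 (in particular the
  empty set) contribute nothing; for \<open>s = 0\<close> this would not be the counting measure.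
  The conversion \<open>enn2real\<close> is harmless because covering sets have finite diameter.
\<close>

definition hausdorff_premeasure ::
  "'a set \<Rightarrow> ('a \<Rightarrow> 'a \<Rightarrow> real) \<Rightarrow> real \<Rightarrow> real \<Rightarrow> 'a set \<Rightarrow> ennreal" where
  "hausdorff_premeasure M d s \<delta> A =
     (INF U \<in> {U :: nat \<Rightarrow> 'a set. A \<subseteq> (\<Union>i. U i) \<and> (\<forall>i. U i \<subseteq> M \<and> ediam d (U i) \<le> ennreal \<delta>)}.
        \<Sum>i. ennreal (enn2real (ediam d (U i)) powr s))"

definition hausdorff_measure ::
  "'a set \<Rightarrow> ('a \<Rightarrow> 'a \<Rightarrow> real) \<Rightarrow> real \<Rightarrow> 'a set \<Rightarrow> ennreal" where
  "hausdorff_measure M d s A = (SUP \<delta>\<in>{0<..}. hausdorff_premeasure M d s \<delta> A)"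

definition ahlfors_regular :: "'a set \<Rightarrow> ('a \<Rightarrow> 'a \<Rightarrow> real) \<Rightarrow> real \<Rightarrow> bool" where
  "ahlfors_regular M d Q \<longleftrightarrow>
     (\<exists>C\<ge>1. \<forall>x\<in>M. \<forall>r>0. ennreal r < ediam d M / 2 \<longrightarrow>
        ennreal (1 / C * r powr Q) \<le> hausdorff_measure M d Q (Metric_space.mball M d x r) \<and>
        hausdorff_measure M d Q (Metric_space.mball M d x r) \<le> ennreal (C * r powr Q))"

definition bilipschitz_equivalent_on ::
  "'a set \<Rightarrow> ('a \<Rightarrow> 'a \<Rightarrow> real) \<Rightarrow> ('a \<Rightarrow> 'a \<Rightarrow> real) \<Rightarrow> bool" where
  "bilipschitz_equivalent_on A d \<rho> \<longleftrightarrow>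
     (\<exists>L\<ge>1. \<forall>p\<in>A. \<forall>q\<in>A. 1 / L * \<rho> p q \<le> d p q \<and> d p q \<le> L * \<rho> p q)"

section \<open>The subRiemannian Heisenberg group\<close>

type_synonym heis = "real \<times> real \<times> real"

fun heis_mult :: "heis \<Rightarrow> heis \<Rightarrow> heis" where
  "heis_mult (x, y, z) (x', y', z') = (x + x', y + y', z + z' + 1 / 2 * (x * y' - y * x'))"

fun heis_X :: "heis \<Rightarrow> heis" where
  "heis_X (x, y, z) = (1, 0, - (y / 2))"

fun heis_Y :: "heis \<Rightarrow> heis" where
  "heis_Y (x, y, z) = (0, 1, x / 2)"

text \<open>The fields are the left translates of the first two coordinate directions at the identity.\<close>

lemma heis_X_left_invariant:
  "((\<lambda>t. heis_mult p (t, 0, 0)) has_vector_derivative heis_X p) (at 0)"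
  by (cases p) (auto intro!: derivative_eq_intros)

lemma heis_Y_left_invariant:
  "((\<lambda>t. heis_mult p (0, t, 0)) has_vector_derivative heis_Y p) (at 0)"
  by (cases p) (auto intro!: derivative_eq_intros)

text \<open>A pair \<open>(s, t)\<close> in \<open>I\<close> encodes a subinterval of \<open>[a, b]\<close>; these may share endpoints only.\<close>

definition absolutely_continuous_curve ::
  "real \<Rightarrow> real \<Rightarrow> (real \<Rightarrow> 'a::metric_space) \<Rightarrow> bool" where
  "absolutely_continuous_curve a b f \<longleftrightarrow>
     (\<forall>\<epsilon>>0. \<exists>\<delta>>0. \<forall>I :: (real \<times> real) set.
        finite I \<and> (\<forall>(s, t)\<in>I. a \<le> s \<and> s \<le> t \<and> t \<le> b) \<and>
        disjoint_family_on (\<lambda>(s, t). {s<..<t}) I \<and> (\<Sum>(s, t)\<in>I. t - s) < \<delta>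
        \<longrightarrow> (\<Sum>(s, t)\<in>I. dist (f s) (f t)) < \<epsilon>)"

text \<open>
  \<open>u\<close> and \<open>v\<close> are the coordinates of the velocity of \<open>\<gamma>\<close> in the frame \<open>(X, Y)\<close>; they are
  determined by \<open>\<gamma>\<close> almost everywhere. Declaring the frame orthonormal, the speed is
  \<open>sqrt (u\<^sup>2 + v\<^sup>2)\<close>, which is integrable because \<open>\<gamma>\<close> is absolutely continuous. Parametrising
  over \<open>[0, 1]\<close> is no restriction, since length is invariant under reparametrisation.
\<close>

definition horizontal_curve ::
  "(real \<Rightarrow> heis) \<Rightarrow> (real \<Rightarrow> real) \<Rightarrow> (real \<Rightarrow> real) \<Rightarrow> bool" where
  "horizontal_curve \<gamma> u v \<longleftrightarrow>
     absolutely_continuous_curve 0 1 \<gamma> \<and>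
     (AE t in lebesgue_on {0..1}.
        (\<gamma> has_vector_derivative (u t *\<^sub>R heis_X (\<gamma> t) + v t *\<^sub>R heis_Y (\<gamma> t))) (at t))"

definition d_cc :: "heis \<Rightarrow> heis \<Rightarrow> real" where
  "d_cc p q = Inf {integral {0..1} (\<lambda>t. sqrt ((u t)\<^sup>2 + (v t)\<^sup>2)) | \<gamma> u v.
                     horizontal_curve \<gamma> u v \<and> \<gamma> 0 = p \<and> \<gamma> 1 = q}"

end

theory Submission
  imports Defs
begin

text \<open>
  The vertical direction of the Heisenberg group is a snowflake, so one can insert shortcuts between
  pairs of points on a common vertical line without creating new geometry. At each of the very sparse
  scales \<open>t = (1 / 2) ^ (n * n)\<close> join the points of a net at distance about \<open>t\<close> in disjoint vertical pairs and let
  each pair have distance at most \<open>(1 / 2) ^ n * t\<close>. The new distance is defined dually, as the supremum of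
  \<open>f p - f q\<close> over the functions \<open>f\<close> that are Lipschitz for a homogeneous distance below \<open>d_cc\<close> and
  vary little on each pair. For a ball of radius \<open>r\<close> only one scale matters; a suitable test function
  shows that the ball lies in at most three homogeneous balls of comparable radius, and regularity
  follows by comparison with Lebesgue measure. A set on which the distances are biLipschitz
  equivalent must avoid, at every fine scale, a fixed proportion around one end of each pair. Hence it
  is Lebesgue null, and therefore null for the Hausdorff measure.
\<close>

section \<open>Absolutely continuous functions\<close>

text \<open>An infimum over chains would require control of chains through shortcuts of all levels.
  Dually, a lower bound for \<open>sdist\<close> takes one test function, and the obstacle is that
  this function has to respect every level at once. Let it have size \<open>r\<close>, and let
  \<open>n\<close> be the first level of cost at most \<open>r\<close>. Coarser constraints then
  hold for free, level \<open>n\<close> is met by equal values at both ends, and on a finer level of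
  scale \<open>t\<close> the ends differ only by \<open>t\<^sup>2 / 2\<close> in height, which a
  Lipschitz function for \<open>hdist s\<close>, \<open>r \<le> s\<close>, sees as at most
  \<open>t\<^sup>2 / (2 * s)\<close>. The quadratic exponents make this affordable: the square of a
  scale is at most its own cost times any coarser cost. Still cost / scale =
  \<open>(1 / 2) ^ n\<close> tends to 0, which defeats every biLipschitz constant. The balls of
  \<open>hdist 0\<close> are explicit boxes, so the geometry is done there; \<open>d_cc\<close>
  enters only through \<open>hdist 0 p q \<le> d_cc p q \<le> 40 * hdist 0 p q\<close>, and the
  analysis of absolutely continuous curves serves the first of these inequalities.\<close>

lemma absolutely_continuous_curve_subinterval:
  assumes "absolutely_continuous_curve a b f" "a \<le> c" "d \<le> b"
  shows "absolutely_continuous_curve c d f"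
  unfolding absolutely_continuous_curve_def
proof (intro allI impI)
  fix \<epsilon> :: real assume "\<epsilon> > 0"
  then obtain \<delta> where \<delta>: "\<delta> > 0" "\<And>I :: (real \<times> real) set.
        finite I \<Longrightarrow> (\<forall>(s, t)\<in>I. a \<le> s \<and> s \<le> t \<and> t \<le> b) \<Longrightarrow>
        disjoint_family_on (\<lambda>(s, t). {s<..<t}) I \<Longrightarrow> (\<Sum>(s, t)\<in>I. t - s) < \<delta>
        \<Longrightarrow> (\<Sum>(s, t)\<in>I. dist (f s) (f t)) < \<epsilon>"
    using assms(1) unfolding absolutely_continuous_curve_def by meson
  show "\<exists>\<delta>>0. \<forall>I. finite I \<and> (\<forall>(s, t)\<in>I. c \<le> s \<and> s \<le> t \<and> t \<le> d) \<and>
        disjoint_family_on (\<lambda>(s, t). {s<..<t}) I \<and> (\<Sum>(s, t)\<in>I. t - s) < \<delta>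
        \<longrightarrow> (\<Sum>(s, t)\<in>I. dist (f s) (f t)) < \<epsilon>"
  proof (intro exI[of _ \<delta>] conjI allI impI \<delta>(1); elim conjE)
    fix I :: "(real \<times> real) set"
    assume I: "finite I" "\<forall>(s, t)\<in>I. c \<le> s \<and> s \<le> t \<and> t \<le> d"
      "disjoint_family_on (\<lambda>(s, t). {s<..<t}) I" "(\<Sum>(s, t)\<in>I. t - s) < \<delta>"
    show "(\<Sum>(s, t)\<in>I. dist (f s) (f t)) < \<epsilon>"
      using I(2) assms(2,3) by (intro \<delta>(2)[OF I(1) _ I(3,4)]) fastforce
  qed
qed

lemma absolutely_continuous_curve_compose:
  assumes "absolutely_continuous_curve a b f" "\<And>x y. dist (h x) (h y) \<le> dist x y"
  shows "absolutely_continuous_curve a b (\<lambda>t. h (f t))"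
  unfolding absolutely_continuous_curve_def
proof (intro allI impI)
  fix \<epsilon> :: real assume "\<epsilon> > 0"
  then obtain \<delta> where \<delta>: "\<delta> > 0" "\<And>I :: (real \<times> real) set.
        finite I \<and> (\<forall>(s, t)\<in>I. a \<le> s \<and> s \<le> t \<and> t \<le> b) \<and>
        disjoint_family_on (\<lambda>(s, t). {s<..<t}) I \<and> (\<Sum>(s, t)\<in>I. t - s) < \<delta>
        \<Longrightarrow> (\<Sum>(s, t)\<in>I. dist (f s) (f t)) < \<epsilon>"
    using assms(1) unfolding absolutely_continuous_curve_def by meson
  have "(\<Sum>(s, t)\<in>I. dist (h (f s)) (h (f t))) \<le> (\<Sum>(s, t)\<in>I. dist (f s) (f t))" for I
    by (intro sum_mono) (auto simp: assms(2))
  then show "\<exists>\<delta>>0. \<forall>I. finite I \<and> (\<forall>(s, t)\<in>I. a \<le> s \<and> s \<le> t \<and> t \<le> b) \<and>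
        disjoint_family_on (\<lambda>(s, t). {s<..<t}) I \<and> (\<Sum>(s, t)\<in>I. t - s) < \<delta>
        \<longrightarrow> (\<Sum>(s, t)\<in>I. dist (h (f s)) (h (f t))) < \<epsilon>"
    using \<delta> by (meson le_less_trans)
qed

lemma lipschitz_absolutely_continuous_curve:
  assumes "\<And>s t. a \<le> s \<Longrightarrow> s \<le> t \<Longrightarrow> t \<le> b \<Longrightarrow> dist (f s) (f t) \<le> L * (t - s)"
  shows "absolutely_continuous_curve a b f"
  unfolding absolutely_continuous_curve_def
proof (intro allI impI)
  fix \<epsilon> :: real assume e: "\<epsilon> > 0"
  show "\<exists>\<delta>>0. \<forall>I. finite I \<and> (\<forall>(s, t)\<in>I. a \<le> s \<and> s \<le> t \<and> t \<le> b) \<and>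
        disjoint_family_on (\<lambda>(s, t). {s<..<t}) I \<and> (\<Sum>(s, t)\<in>I. t - s) < \<delta>
        \<longrightarrow> (\<Sum>(s, t)\<in>I. dist (f s) (f t)) < \<epsilon>"
  proof (intro exI[of _ "\<epsilon> / (\<bar>L\<bar> + 1)"] conjI allI impI; (elim conjE)?)
    show "0 < \<epsilon> / (\<bar>L\<bar> + 1)" using e by (simp add: add_nonneg_pos)
    fix I :: "(real \<times> real) set"
    assume I: "finite I" "\<forall>(s, t)\<in>I. a \<le> s \<and> s \<le> t \<and> t \<le> b"
      and s: "(\<Sum>(s, t)\<in>I. t - s) < \<epsilon> / (\<bar>L\<bar> + 1)"
    have "(\<Sum>(s, t)\<in>I. dist (f s) (f t)) \<le> (\<Sum>(s, t)\<in>I. (\<bar>L\<bar> + 1) * (t - s))"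
    proof (intro sum_mono, clarify)
      fix s t assume "(s, t) \<in> I"
      then have "a \<le> s" "s \<le> t" "t \<le> b" using I(2) by auto
      then have "dist (f s) (f t) \<le> L * (t - s)" by (rule assms)
      also have "\<dots> \<le> (\<bar>L\<bar> + 1) * (t - s)"
        using \<open>s \<le> t\<close> by (intro mult_right_mono) auto
      finally show "dist (f s) (f t) \<le> (\<bar>L\<bar> + 1) * (t - s)" .
    qed
    also have "\<dots> = (\<bar>L\<bar> + 1) * (\<Sum>(s, t)\<in>I. t - s)"
      by (simp add: sum_distrib_left case_prod_unfold)
    also have "\<dots> < \<epsilon>" using s by (simp add: field_simps add_nonneg_pos)
    finally show "(\<Sum>(s, t)\<in>I. dist (f s) (f t)) < \<epsilon>" .
  qed
qed

text \<open>The intervals of a tagged partial division have disjoint interiors and total length at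
  most the measure of \<open>T\<close>. This is the form in which Henstock sums can use absolute
  continuity.\<close>

lemma absolutely_continuous_curve_tagged_sum:
  fixes f :: "real \<Rightarrow> real"
  assumes ac: "absolutely_continuous_curve a b f" and e: "e > 0"
  obtains \<delta> where "\<delta> > 0"
    "\<And>q T. q tagged_partial_division_of {a..b} \<Longrightarrow> \<Union>(snd ` q) \<subseteq> T \<Longrightarrow> T \<in> lmeasurable
      \<Longrightarrow> measure lebesgue T < \<delta> \<Longrightarrow> (\<Sum>(x,K)\<in>q. \<bar>f (Sup K) - f (Inf K)\<bar>) < e"
proof -
  obtain \<delta> where \<delta>: "\<delta> > 0" and *: "\<And>I :: (real \<times> real) set.
        finite I \<and> (\<forall>(s, t)\<in>I. a \<le> s \<and> s \<le> t \<and> t \<le> b) \<and>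
        disjoint_family_on (\<lambda>(s, t). {s<..<t}) I \<and> (\<Sum>(s, t)\<in>I. t - s) < \<delta>
        \<Longrightarrow> (\<Sum>(s, t)\<in>I. dist (f s) (f t)) < e"
    using ac e unfolding absolutely_continuous_curve_def by meson
  show ?thesis
  proof (rule that[OF \<delta>])
    fix q T assume q: "q tagged_partial_division_of {a..b}" and T: "\<Union>(snd ` q) \<subseteq> T"
      "T \<in> lmeasurable" "measure lebesgue T < \<delta>"
    note D = tagged_partial_division_ofD[OF q]
    have K: "\<exists>u v. K = {u..v} \<and> u \<le> v \<and> a \<le> u \<and> v \<le> b \<and> Inf K = u \<and> Sup K = v"
      if xK: "(x, K) \<in> q" for x K
    proof -
      obtain u v where uv: "K = {u..v}" using D(4)[OF xK] by (metis box_real(2))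
      moreover have "x \<in> K" "K \<subseteq> {a..b}" using D(2,3) xK by auto
      ultimately have "u \<le> v" "{u..v} \<subseteq> {a..b}" by auto
      then show ?thesis using uv by (intro exI[of _ u] exI[of _ v]) auto
    qed
    \<comment> \<open>Degenerate intervals have zero increment. Without them all interiors are
      nonempty, so their disjointness forces the endpoint map \<open>E\<close> to be
      injective.\<close>
    define r where "r = {(x,K)\<in>q. Inf K < Sup K}"
    define E where "E = (\<lambda>(x::real,K::real set). (Inf K, Sup K))"
    have rq: "r \<subseteq> q" by (auto simp: r_def)
    have fr: "finite r" using D(1) rq finite_subset by auto
    have dis: "{Inf K<..<Sup K} \<inter> {Inf K'<..<Sup K'} = {}"
      if xK: "(x,K) \<in> q" "(x',K') \<in> q" "(x,K) \<noteq> (x',K')" for x K x' K'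
    proof -
      obtain u v where "K = {u..v}" "Inf K = u" "Sup K = v" using K[OF xK(1)] by blast
      moreover obtain u' v' where "K' = {u'..v'}" "Inf K' = u'" "Sup K' = v'"
        using K[OF xK(2)] by blast
      ultimately show ?thesis
        using D(5)[OF xK] by simp
    qed
    have inj: "inj_on E r"
    proof (rule inj_onI, clarsimp simp: E_def r_def)
      fix x K x' K' assume a: "(x,K) \<in> q" "(x',K') \<in> q" "Inf K' < Sup K'" "Inf K = Inf K'" "Sup K = Sup K'"
      show "x = x' \<and> K = K'"
      proof (rule ccontr)
        assume "\<not> ?thesis"
        then have "{Inf K<..<Sup K} \<inter> {Inf K'<..<Sup K'} = {}" using dis a by blast
        then show False using a dense[OF a(3)] by auto
      qed
    qed
    have djr: "disjoint_family_on (\<lambda>(x,K). {Inf K<..<Sup K}) r"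
      unfolding disjoint_family_on_def using dis rq by fast
    have "disjoint_family_on (\<lambda>(s, t). {s<..<t}) (E ` r)"
      unfolding disjoint_family_on_def
    proof (intro ballI impI)
      fix i j assume "i \<in> E ` r" "j \<in> E ` r" and ne: "i \<noteq> j"
      then obtain x K x' K' where *: "i = (Inf K, Sup K)" "j = (Inf K', Sup K')" "(x,K) \<in> r" "(x',K') \<in> r"
        unfolding E_def by auto
      then have "(x,K) \<noteq> (x',K')" using ne by auto
      then show "(case i of (s, t) \<Rightarrow> {s<..<t}) \<inter> (case j of (s, t) \<Rightarrow> {s<..<t}) = {}"
        using dis[of x K x' K'] * rq by auto
    qed
    moreover have "(\<Sum>(s, t)\<in>E ` r. t - s) < \<delta>"
    proof -
      have "(\<Sum>(s, t)\<in>E ` r. t - s) = (\<Sum>(x,K)\<in>r. Sup K - Inf K)"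
        by (subst sum.reindex[OF inj]) (simp add: E_def case_prod_unfold)
      also have "\<dots> = (\<Sum>y\<in>r. measure lebesgue (case y of (x,K) \<Rightarrow> {Inf K<..<Sup K}))"
        by (rule sum.cong) (auto simp: r_def)
      also have "\<dots> = measure lebesgue (\<Union>y\<in>r. case y of (x,K) \<Rightarrow> {Inf K<..<Sup K})"
        by (rule measure_finite_Union[symmetric]) (use fr djr in \<open>auto simp: r_def\<close>)
      also have "\<dots> \<le> measure lebesgue T"
      proof (rule measure_mono_fmeasurable)
        show "(\<Union>y\<in>r. case y of (x,K) \<Rightarrow> {Inf K<..<Sup K}) \<subseteq> T"
        proof (clarsimp)
          fix z x K assume z: "(x,K) \<in> r" "Inf K < z" "z < Sup K"
          then have "z \<in> K" using K[of x K] rq by fastforce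
          then show "z \<in> T" using z rq T(1) by force
        qed
      qed (use T(2) fr in \<open>auto intro!: sets.finite_UN\<close>)
      finally show ?thesis using T(3) by simp
    qed
    moreover have "\<forall>(s, t)\<in>E ` r. a \<le> s \<and> s \<le> t \<and> t \<le> b"
      using K rq by (fastforce simp: E_def)
    ultimately have "(\<Sum>(s, t)\<in>E ` r. dist (f s) (f t)) < e"
      using *[of "E ` r"] fr by blast
    also have "(\<Sum>(s, t)\<in>E ` r. dist (f s) (f t)) = (\<Sum>(x,K)\<in>r. \<bar>f (Sup K) - f (Inf K)\<bar>)"
      by (subst sum.reindex[OF inj]) (simp add: E_def case_prod_unfold dist_real_def abs_minus_commute)
    also have "\<dots> = (\<Sum>(x,K)\<in>q. \<bar>f (Sup K) - f (Inf K)\<bar>)"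
    proof (rule sum.mono_neutral_left)
      show "\<forall>i\<in>q - r. (case i of (x, K) \<Rightarrow> \<bar>f (Sup K) - f (Inf K)\<bar>) = 0"
      proof
        fix i assume "i \<in> q - r"
        then obtain x K' where a: "i = (x,K')" "(x,K') \<in> q" "\<not> Inf K' < Sup K'"
          by (cases i) (auto simp: r_def)
        obtain u v where "u \<le> v" "Inf K' = u" "Sup K' = v" using K[OF a(2)] by blast
        then show "(case i of (x, K) \<Rightarrow> \<bar>f (Sup K) - f (Inf K)\<bar>) = 0" using a by auto
      qed
    qed (use D rq in auto)
    finally show "(\<Sum>(x,K)\<in>q. \<bar>f (Sup K) - f (Inf K)\<bar>) < e" .
  qed
qed

text \<open>
  Henstock's gauge proves this directly: near points of differentiability the gauge comes from the
  derivative; near the exceptional null set it confines the intervals to an open set of small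
  measure, where absolute continuity bounds the increments.
\<close>

lemma absolutely_continuous_has_integral:
  fixes f g :: "real \<Rightarrow> real"
  assumes ac: "absolutely_continuous_curve a b f" and ab: "a \<le> b"
    and ae: "AE t in lebesgue_on {a..b}. (f has_vector_derivative g t) (at t)"
  shows "(g has_integral (f b - f a)) {a..b}"
proof (cases "a = b")
  case False
  then have ab: "a < b" using ab by simp
  obtain E where E: "E \<in> null_sets lebesgue" "\<And>t. t \<in> {a..b} \<Longrightarrow> t \<notin> E \<Longrightarrow> (f has_vector_derivative g t) (at t)"
  proof -
    have "AE t in lebesgue. t \<in> {a..b} \<longrightarrow> (f has_vector_derivative g t) (at t)"
      using ae by (subst (asm) AE_restrict_space_iff) auto
    then obtain E where "E \<in> null_sets lebesgue" "{t \<in> space lebesgue. \<not> (t \<in> {a..b} \<longrightarrow> (f has_vector_derivative g t) (at t))} \<subseteq> E"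
      unfolding eventually_ae_filter by blast
    then show ?thesis by (intro that[of E]) auto
  qed
  \<comment> \<open>With the integrand reset to 0 on \<open>E\<close>, tags in \<open>E\<close>
    leave only the increments of \<open>f\<close>; changing a null set at the end restores
    \<open>g\<close>.\<close>
  define h where "h t = (if t \<in> E then 0 else g t)" for t
  have "(h has_integral (f b - f a)) {a..b}"
    unfolding has_integral_factor_content box_real[symmetric]
  proof (intro allI impI)
    fix e :: real assume e: "e > 0"
    \<comment> \<open>Half of the permitted error is for the intervals tagged in \<open>E\<close>,
      half for the others.\<close>
    define \<epsilon> where "\<epsilon> = e * (b - a) / 2"
    have \<epsilon>: "\<epsilon> > 0" using e ab by (simp add: \<epsilon>_def)
    obtain \<delta> where \<delta>: "\<delta> > 0" and small: "\<And>q T. q tagged_partial_division_of {a..b} \<Longrightarrow>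
        \<Union>(snd ` q) \<subseteq> T \<Longrightarrow> T \<in> lmeasurable \<Longrightarrow> measure lebesgue T < \<delta> \<Longrightarrow>
        (\<Sum>(x,K)\<in>q. \<bar>f (Sup K) - f (Inf K)\<bar>) < \<epsilon>"
      using absolutely_continuous_curve_tagged_sum[OF ac \<epsilon>] by blast
    obtain T where T: "open T" "E \<subseteq> T" "T - E \<in> lmeasurable" "emeasure lebesgue (T - E) < ennreal \<delta>"
      using sets_lebesgue_outer_open[of E \<delta>] E(1) \<delta> by (auto dest: null_setsD2)
    have Em: "E \<in> lmeasurable" "measure lebesgue E = 0"
      using E(1) by (auto simp: fmeasurable_def null_sets_def measure_def)
    have "(T - E) \<union> E \<in> lmeasurable" using T(3) Em(1) by (rule fmeasurable.Un)
    moreover have "(T - E) \<union> E = T" using T(2) by auto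
    ultimately have Tm: "T \<in> lmeasurable" by simp
    have "measure lebesgue T = measure lebesgue (T - E)"
      using measure_Diff_null_set[OF _ E(1), of T] Tm by auto
    also have "\<dots> < \<delta>" using T(3,4) \<delta> by (simp add: emeasure_eq_measure2 ennreal_less_iff)
    finally have Tl: "measure lebesgue T < \<delta>" .
    have "\<exists>d>0. (x \<in> {a..b} \<and> x \<notin> E \<longrightarrow>
         (\<forall>y. \<bar>y-x\<bar> < d \<longrightarrow> \<bar>f y - f x - (y-x) * g x\<bar> \<le> (e/2) * \<bar>y-x\<bar>)) \<and> (x \<in> E \<longrightarrow> ball x d \<subseteq> T)" for x
    proof (cases "x \<in> E")
      case True
      then show ?thesis using T(1,2) by (meson openE subsetD)
    next
      case F: False
      show ?thesis
      proof (cases "x \<in> {a..b}")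
        case True
        have "(f has_derivative (\<lambda>s. s * g x)) (at x)" using E(2)[OF True F]
          by (simp add: has_vector_derivative_def)
        then have "\<exists>d>0. \<forall>y. norm (y - x) < d \<longrightarrow> norm (f y - f x - (y-x) * g x) \<le> (e/2) * norm (y-x)"
          using e unfolding has_derivative_at_alt by (meson half_gt_zero)
        then show ?thesis using F by auto
      qed (use F in \<open>auto intro: exI[of _ 1]\<close>)
    qed
    then obtain d where d: "\<And>x. d x > 0" "\<And>x y. x \<in> {a..b} \<Longrightarrow> x \<notin> E \<Longrightarrow> \<bar>y-x\<bar> < d x \<Longrightarrow>
        \<bar>f y - f x - (y-x) * g x\<bar> \<le> (e/2) * \<bar>y-x\<bar>" "\<And>x. x \<in> E \<Longrightarrow> ball x (d x) \<subseteq> T"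
      by metis
    show "\<exists>d. gauge d \<and> (\<forall>p. p tagged_division_of (cbox a b) \<and> d fine p \<longrightarrow>
      norm ((\<Sum>(x, k)\<in>p. measure lborel k *\<^sub>R h x) - (f b - f a)) \<le> e * measure lborel (cbox a b))"
    proof (intro exI[of _ "\<lambda>x. ball x (d x)"] conjI allI impI; (elim conjE)?)
      show "gauge (\<lambda>x. ball x (d x))" using d(1) gauge_ball_dependent by blast
      fix p assume p: "p tagged_division_of cbox a b" and fp: "(\<lambda>x. ball x (d x)) fine p"
      have fin: "finite p" using p by auto
      have ba: "b - a = (\<Sum>(x,K)\<in>p. Sup K - Inf K)" "f b - f a = (\<Sum>(x,K)\<in>p. f(Sup K) - f(Inf K))"
        using additive_tagged_division_1[of a b p "\<lambda>x. x"] additive_tagged_division_1[of a b p f] ab p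
        by (simp_all only: box_real less_imp_le)
      define q where "q = {(x,K)\<in>p. x \<in> E}"
      have qp: "q \<subseteq> p" by (auto simp: q_def)
      have part: "q tagged_partial_division_of {a..b}"
        using p qp tagged_partial_division_subset unfolding tagged_division_of_def by auto
      have "\<Union>(snd ` q) \<subseteq> T"
      proof (clarsimp simp: q_def)
        fix y x K assume a: "y \<in> K" "(x,K) \<in> p" "x \<in> E"
        then have "K \<subseteq> ball x (d x)" using fp unfolding fine_def by auto
        then show "y \<in> T" using d(3)[OF a(3)] a by auto
      qed
      from small[OF part this Tm Tl]
      have A: "(\<Sum>(x,K)\<in>q. \<bar>f (Sup K) - f (Inf K)\<bar>) < \<epsilon>" .
      have tagged: "\<bar>measure lborel K * h x - (f (Sup K) - f (Inf K))\<bar> \<le> (e/2) * (Sup K - Inf K) \<and> Sup K - Inf K \<ge> 0"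
        if "(x,K) \<in> p" "x \<notin> E" for x K
      proof -
        obtain u v where uv: "K = {u..v}" "x \<in> K" "K \<subseteq> {a..b}"
          using tagged_division_ofD(2-4)[OF p \<open>(x,K) \<in> p\<close>] by (metis box_real(2))
        then have le: "u \<le> x" "x \<le> v" "x \<in> {a..b}" by auto
        have K: "K \<subseteq> ball x (d x)" using fp that unfolding fine_def by auto
        have "u \<in> K" "v \<in> K" using le uv(1) by auto
        then have n: "\<bar>u - x\<bar> < d x" "\<bar>v - x\<bar> < d x" using K by (auto simp: dist_real_def)
        have "\<bar>f u - f x - (u-x) * g x\<bar> \<le> (e/2) * (x - u)" "\<bar>f v - f x - (v-x) * g x\<bar> \<le> (e/2) * (v - x)"
          using d(2)[OF le(3) that(2) n(1)] d(2)[OF le(3) that(2) n(2)] le by auto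
        \<comment> \<open>The tag lies between \<open>u\<close> and \<open>v\<close>, so the
          linearisation errors at the two ends add up to a multiple of \<open>v - u\<close>.\<close>
        then have "\<bar>(f u - f x - (u-x) * g x) - (f v - f x - (v-x) * g x)\<bar> \<le> (e/2) * (x - u) + (e/2) * (v - x)"
          by linarith
        moreover have "(f u - f x - (u-x) * g x) - (f v - f x - (v-x) * g x) = (v - u) * g x - (f v - f u)"
          "(e/2) * (x - u) + (e/2) * (v - x) = (e/2) * (v - u)"
          by (simp_all add: algebra_simps add_divide_distrib diff_divide_distrib)
        moreover have "Inf K = u" "Sup K = v" "measure lborel K = v - u"
          using uv(1) le by (simp_all add: order_trans[OF le(1,2)])
        ultimately show ?thesis using le that(2) by (simp only: h_def if_False) simp
      qed
      have cz: "measure lborel K * h x = 0" if "(x,K) \<in> q" for x K using that by (auto simp: q_def h_def)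
      have "(\<Sum>(x, k)\<in>p. measure lborel k *\<^sub>R h x) - (f b - f a) = (\<Sum>(x,K)\<in>p. measure lborel K * h x - (f (Sup K) - f (Inf K)))"
        unfolding ba(2) by (simp add: sum_subtractf case_prod_unfold)
      also have "\<bar>\<dots>\<bar> \<le> (\<Sum>(x,K)\<in>p. \<bar>measure lborel K * h x - (f (Sup K) - f (Inf K))\<bar>)"
        using sum_abs[of "\<lambda>(x,K). measure lborel K * h x - (f (Sup K) - f (Inf K))" p]
        by (simp add: case_prod_unfold)
      also have "\<dots> = (\<Sum>(x,K)\<in>q. \<bar>measure lborel K * h x - (f (Sup K) - f (Inf K))\<bar>) +
         (\<Sum>(x,K)\<in>p - q. \<bar>measure lborel K * h x - (f (Sup K) - f (Inf K))\<bar>)"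
        using sum.subset_diff[OF qp fin] by (simp add: add.commute)
      also have "(\<Sum>(x,K)\<in>q. \<bar>measure lborel K * h x - (f (Sup K) - f (Inf K))\<bar>) = (\<Sum>(x,K)\<in>q. \<bar>f (Sup K) - f (Inf K)\<bar>)"
        by (rule sum.cong) (auto simp: cz)
      also have "(\<Sum>(x,K)\<in>p - q. \<bar>measure lborel K * h x - (f (Sup K) - f (Inf K))\<bar>) \<le> (\<Sum>(x,K)\<in>p - q. (e/2) * (Sup K - Inf K))"
        using tagged by (intro sum_mono) (auto simp: q_def simp del: divide_const_simps)
      also have "\<dots> \<le> (\<Sum>(x,K)\<in>p. (e/2) * (Sup K - Inf K))"
      proof (rule sum_mono2[OF fin])
        fix y assume "y \<in> p - (p - q)"
        then obtain x K where y: "y = (x,K)" "(x,K) \<in> p" by (cases y) auto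
        then obtain u v where "K = {u..v}" "x \<in> K"
          using tagged_division_ofD(2,4)[OF p y(2)] by (metis box_real(2))
        then show "0 \<le> (case y of (x,K) \<Rightarrow> (e/2) * (Sup K - Inf K))" using e y by auto
      qed auto
      also have "\<dots> = (e/2) * (b - a)" unfolding ba(1) by (simp add: sum_distrib_left case_prod_unfold)
      finally show "norm ((\<Sum>(x, k)\<in>p. measure lborel k *\<^sub>R h x) - (f b - f a)) \<le> e * measure lborel (cbox a b)"
        using A ab by (simp add: \<epsilon>_def field_simps)
    qed
  qed
  then show ?thesis
    by (rule has_integral_spike[where S=E, rotated 2]) (use E(1) in \<open>auto simp: h_def negligible_iff_null_sets\<close>)
qed (simp add: has_integral_refl)

text \<open>On intervals shorter than the \<delta> for error 1, the indefinite integral of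
  \<open>g\<close> has variation at most 1, so the absolute value of \<open>g\<close> is integrable
  there; finitely many such intervals fill [0, 1]. This makes the speed of a horizontal curve
  integrable; otherwise \<open>integral\<close> would have the default value 0 and the length would
  bound nothing.\<close>

lemma absolutely_continuous_absolutely_integrable:
  fixes f g :: "real \<Rightarrow> real"
  assumes ac: "absolutely_continuous_curve 0 1 f"
    and ae: "AE t in lebesgue_on {0..1}. (f has_vector_derivative g t) (at t)"
  shows "g absolutely_integrable_on {0..1}"
proof -
  have FTC: "(g has_integral (f d - f c)) {c..d}" if "0 \<le> c" "c \<le> d" "d \<le> 1" for c d
  proof (rule absolutely_continuous_has_integral[OF absolutely_continuous_curve_subinterval[OF ac]])
    have "AE t in lebesgue. t \<in> {0..1} \<longrightarrow> (f has_vector_derivative g t) (at t)"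
      using ae by (subst (asm) AE_restrict_space_iff) auto
    then have "AE t in lebesgue. t \<in> {c..d} \<longrightarrow> (f has_vector_derivative g t) (at t)"
      by (rule eventually_mono) (use that in auto)
    then show "AE t in lebesgue_on {c..d}. (f has_vector_derivative g t) (at t)"
      by (subst AE_restrict_space_iff) auto
  qed (use that in auto)
  obtain \<delta> where \<delta>: "\<delta> > 0" and small: "\<And>q T. q tagged_partial_division_of {0..1} \<Longrightarrow>
        \<Union>(snd ` q) \<subseteq> T \<Longrightarrow> T \<in> lmeasurable \<Longrightarrow> measure lebesgue T < \<delta> \<Longrightarrow>
        (\<Sum>(x,K)\<in>q. \<bar>f (Sup K) - f (Inf K)\<bar>) < 1"
    using absolutely_continuous_curve_tagged_sum[OF ac, of 1] by auto
  have loc: "g absolutely_integrable_on {c..d}" if cd: "0 \<le> c" "c \<le> d" "d \<le> 1" "d - c < \<delta>" for c d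
    unfolding box_real[symmetric]
  proof (rule bounded_variation_absolutely_integrable_interval)
    show "g integrable_on cbox c d" using FTC cd by (auto intro: has_integral_integrable)
    fix D assume D: "D division_of cbox c d"
    define q where "q = (\<lambda>K. (Inf K, K)) ` D"
    have K: "\<exists>u v. K = {u..v} \<and> u \<le> v \<and> c \<le> u \<and> v \<le> d" if KD: "K \<in> D" for K
    proof -
      obtain u v where "K = {u..v}" "K \<noteq> {}" "K \<subseteq> {c..d}" using D KD by (auto simp: division_of_def)
      then show ?thesis by (intro exI[of _ u] exI[of _ v]) auto
    qed
    have "q tagged_partial_division_of {0..1}"
      unfolding tagged_partial_division_of_def q_def
    proof (intro conjI allI impI)
      show "finite ((\<lambda>K. (Inf K, K)) ` D)" using D by auto
      fix x K assume "(x,K) \<in> (\<lambda>K. (Inf K, K)) ` D"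
      then obtain u v where "K = {u..v}" "u \<le> v" "c \<le> u" "v \<le> d" "x = Inf K" using K by blast
      then show "x \<in> K" "K \<subseteq> {0..1}" "\<exists>a b. K = cbox a b" using cd by auto
    next
      fix x K x' K' assume "(x,K) \<in> (\<lambda>K. (Inf K, K)) ` D \<and> (x',K') \<in> (\<lambda>K. (Inf K, K)) ` D \<and> (x,K) \<noteq> (x',K')"
      then have "K \<in> D" "K' \<in> D" "K \<noteq> K'" by auto
      then show "interior K \<inter> interior K' = {}" using D by (simp add: division_of_def)
    qed
    moreover have "\<Union>(snd ` q) \<subseteq> {c..d}" using K by (force simp: q_def)
    ultimately have "(\<Sum>(x,K)\<in>q. \<bar>f (Sup K) - f (Inf K)\<bar>) < 1" by (rule small) (use cd in auto)
    also have "(\<Sum>(x,K)\<in>q. \<bar>f (Sup K) - f (Inf K)\<bar>) = (\<Sum>K\<in>D. \<bar>f (Sup K) - f (Inf K)\<bar>)"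
      unfolding q_def by (subst sum.reindex) (auto simp: inj_on_def)
    also have "\<dots> = (\<Sum>K\<in>D. norm (integral K g))"
    proof (rule sum.cong)
      fix K assume "K \<in> D"
      then obtain u v where "K = {u..v}" "u \<le> v" "c \<le> u" "v \<le> d" using K by blast
      moreover have "integral {u..v} g = f v - f u"
        using FTC[of u v] calculation cd by (intro integral_unique) auto
      ultimately show "\<bar>f (Sup K) - f (Inf K)\<bar> = norm (integral K g)" by simp
    qed simp
    finally show "(\<Sum>K\<in>D. norm (integral K g)) \<le> 1" by simp
  qed
  obtain N :: nat where N: "N > 0" "1 / real N < \<delta>"
    using \<delta> nat_approx_posE[of \<delta>] by (metis of_nat_Suc zero_less_Suc)
  have "(\<lambda>t. \<bar>g t\<bar>) integrable_on {0..real k / real N}" if "k \<le> N" for k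
    using that
  proof (induction k)
    case (Suc k)
    have "g absolutely_integrable_on {real k / real N..real (Suc k) / real N}"
      using N Suc.prems by (intro loc) (auto simp: field_simps)
    then have "(\<lambda>t. \<bar>g t\<bar>) integrable_on {real k / real N..real (Suc k) / real N}"
      by (auto simp: absolutely_integrable_on_def)
    moreover have "(\<lambda>t. \<bar>g t\<bar>) integrable_on {0..real k / real N}" using Suc by simp
    moreover have "0 \<le> real k / real N" "real k / real N \<le> real (Suc k) / real N"
      by (simp_all add: divide_right_mono)
    ultimately show ?case
      using Henstock_Kurzweil_Integration.integrable_combine by blast
  qed (use integrable_on_refl[of "\<lambda>t. \<bar>g t\<bar>" 0] in simp)
  from this[of N] have "(\<lambda>t. \<bar>g t\<bar>) integrable_on {0..1}" using N by simp
  moreover have "g integrable_on {0..1}" using FTC[of 0 1] by (auto intro: has_integral_integrable)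
  ultimately show ?thesis by (simp add: absolutely_integrable_on_def)
qed

section \<open>Homogeneous distances\<close>

text \<open>The vertical coordinate of \<open>p\<^sup>-\<^sup>1 q\<close>.\<close>

definition heis_height :: "heis \<Rightarrow> heis \<Rightarrow> real" where
  "heis_height p q = snd (snd q) - snd (snd p) - (fst p * fst (snd q) - fst (snd p) * fst q) / 2"

text \<open>
  The inverse function of \<open>t \<mapsto> t\<^sup>2 + s t\<close>. Thus \<open>hdist 0\<close> below is homogeneous, whereas \<open>hdist s\<close> is
  comparable to it above scale \<open>s\<close> and controlled by \<open>height / s\<close> in the vertical direction.
\<close>

definition hgauge :: "real \<Rightarrow> real \<Rightarrow> real" where
  "hgauge s w = (sqrt (s\<^sup>2 + 4 * w) - s) / 2"

definition hdist :: "real \<Rightarrow> heis \<Rightarrow> heis \<Rightarrow> real" where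
  "hdist s p q = max (max \<bar>fst q - fst p\<bar> \<bar>fst (snd q) - fst (snd p)\<bar>) (hgauge s \<bar>heis_height p q\<bar>)"

lemma hgauge_le_iff:
  assumes "0 \<le> s" "0 \<le> w" "0 \<le> t"
  shows "hgauge s w \<le> t \<longleftrightarrow> w \<le> t\<^sup>2 + s * t"
proof -
  have "hgauge s w \<le> t \<longleftrightarrow> sqrt (s\<^sup>2 + 4 * w) \<le> 2 * t + s"
    by (simp add: hgauge_def field_simps)
  also have "\<dots> \<longleftrightarrow> sqrt (s\<^sup>2 + 4 * w) \<le> sqrt ((2 * t + s)\<^sup>2)" using assms by simp
  also have "\<dots> \<longleftrightarrow> s\<^sup>2 + 4 * w \<le> (2 * t + s)\<^sup>2" by (rule real_sqrt_le_iff)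
  also have "\<dots> \<longleftrightarrow> w \<le> t\<^sup>2 + s * t" by (auto simp: power2_eq_square algebra_simps)
  finally show ?thesis .
qed

lemma hgauge_le_divide: "0 < s \<Longrightarrow> 0 \<le> w \<Longrightarrow> hgauge s w \<le> w / s"
  by (subst hgauge_le_iff) auto

lemma heis_height_swap: "heis_height q p = - heis_height p q"
  by (simp add: heis_height_def field_simps)

lemma heis_height_self [simp]: "heis_height p p = 0"
  by (simp add: heis_height_def)

text \<open>The correction is the cocycle of the group law, half the determinant of the two
  horizontal displacements.\<close>

lemma heis_height_add:
  "heis_height p q = heis_height p m + heis_height m q +
     ((fst m - fst p) * (fst (snd q) - fst (snd m)) - (fst (snd m) - fst (snd p)) * (fst q - fst m)) / 2"
  by (simp add: heis_height_def field_simps)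

lemma hdist_commute: "hdist s p q = hdist s q p"
  by (simp add: hdist_def heis_height_swap[of q p] abs_minus_commute)

lemma hdist_nonneg: "0 \<le> hdist s p q"
  by (simp add: hdist_def le_max_iff_disj)

lemma hdist_self [simp]: "0 \<le> s \<Longrightarrow> hdist s p p = 0"
  by (simp add: hdist_def hgauge_def)

lemma hdist_le_iff:
  assumes "0 \<le> s" "0 \<le> t"
  shows "hdist s p q \<le> t \<longleftrightarrow> \<bar>fst q - fst p\<bar> \<le> t \<and> \<bar>fst (snd q) - fst (snd p)\<bar> \<le> t \<and>
     \<bar>heis_height p q\<bar> \<le> t\<^sup>2 + s * t"
  using hgauge_le_iff[OF assms(1) _ assms(2), of "\<bar>heis_height p q\<bar>"] by (auto simp: hdist_def)

lemma hdist_less_iff: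
  assumes "0 \<le> s" "0 < t"
  shows "hdist s p q < t \<longleftrightarrow> \<bar>fst q - fst p\<bar> < t \<and> \<bar>fst (snd q) - fst (snd p)\<bar> < t \<and>
     \<bar>heis_height p q\<bar> < t\<^sup>2 + s * t"
proof -
  have "hgauge s \<bar>heis_height p q\<bar> < t \<longleftrightarrow> sqrt (s\<^sup>2 + 4 * \<bar>heis_height p q\<bar>) < sqrt ((2 * t + s)\<^sup>2)"
    using assms by (simp add: hgauge_def field_simps)
  also have "\<dots> \<longleftrightarrow> s\<^sup>2 + 4 * \<bar>heis_height p q\<bar> < (2 * t + s)\<^sup>2"
    by (rule real_sqrt_less_iff)
  also have "\<dots> \<longleftrightarrow> \<bar>heis_height p q\<bar> < t\<^sup>2 + s * t" by (auto simp: power2_eq_square algebra_simps)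
  finally show ?thesis by (auto simp: hdist_def)
qed

text \<open>Horizontal displacements of at most \<open>t1\<close> and \<open>t2\<close> give a
  cocycle of at most \<open>t1 * t2\<close>, while \<open>(t1 + t2)\<^sup>2\<close> has room for
  \<open>2 * t1 * t2\<close>; the softening term \<open>s * t\<close> is additive.\<close>

lemma hdist_triangle:
  assumes s: "0 \<le> s"
  shows "hdist s p q \<le> hdist s p m + hdist s m q"
proof -
  define t1 t2 where t: "t1 = hdist s p m" "t2 = hdist s m q"
  have nn: "0 \<le> t1" "0 \<le> t2" by (auto simp: t hdist_nonneg)
  have 1: "\<bar>fst m - fst p\<bar> \<le> t1" "\<bar>fst (snd m) - fst (snd p)\<bar> \<le> t1" "\<bar>heis_height p m\<bar> \<le> t1\<^sup>2 + s * t1"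
    using hdist_le_iff[OF s nn(1), of p m] by (auto simp: t)
  have 2: "\<bar>fst q - fst m\<bar> \<le> t2" "\<bar>fst (snd q) - fst (snd m)\<bar> \<le> t2" "\<bar>heis_height m q\<bar> \<le> t2\<^sup>2 + s * t2"
    using hdist_le_iff[OF s nn(2), of m q] by (auto simp: t)
  have "\<bar>(fst m - fst p) * (fst (snd q) - fst (snd m))\<bar> \<le> t1 * t2"
       "\<bar>(fst (snd m) - fst (snd p)) * (fst q - fst m)\<bar> \<le> t1 * t2"
    using 1 2 by (auto simp: abs_mult intro!: mult_mono)
  then have "\<bar>heis_height p q\<bar> \<le> t1\<^sup>2 + s * t1 + (t2\<^sup>2 + s * t2) + t1 * t2"
    using 1(3) 2(3) heis_height_add[of p q m]
    by (simp only: abs_le_iff diff_divide_distrib) linarith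
  also have "\<dots> \<le> (t1 + t2)\<^sup>2 + s * (t1 + t2)"
    using nn by (simp add: power2_eq_square algebra_simps)
  finally have "\<bar>heis_height p q\<bar> \<le> (t1 + t2)\<^sup>2 + s * (t1 + t2)" .
  then have "hdist s p q \<le> t1 + t2"
    using 1 2 nn by (subst hdist_le_iff[OF s]) auto
  then show ?thesis by (simp add: t)
qed

lemma hdist_antimono: "0 \<le> s \<Longrightarrow> hdist s p q \<le> hdist 0 p q"
  using hdist_le_iff[of 0 "hdist 0 p q" p q] hdist_nonneg[of 0 p q]
  by (subst hdist_le_iff) (auto intro: add_increasing2)

lemma hdist_eq_0_iff: "hdist 0 p q = 0 \<longleftrightarrow> p = q"
proof
  assume "hdist 0 p q = 0"
  then have "hdist 0 p q \<le> 0" by simp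
  then have "fst q = fst p" "fst (snd q) = fst (snd p)" "heis_height p q = 0"
    by (auto simp: hdist_le_iff)
  then show "p = q" by (auto simp: heis_height_def prod_eq_iff)
qed simp

section \<open>Comparison with the Carnot-Caratheodory distance\<close>

lemma heis_frame_simps [simp]:
  "fst (heis_X p) = 1" "fst (snd (heis_X p)) = 0" "snd (snd (heis_X p)) = - (fst (snd p) / 2)"
  "fst (heis_Y p) = 0" "fst (snd (heis_Y p)) = 1" "snd (snd (heis_Y p)) = fst p / 2"
  by (cases p, simp)+

text \<open>Each horizontal coordinate moves by at most the length \<open>L\<close>. The height is a
  signed area swept as seen from the starting point, with integrand at most \<open>L\<close> times
  the speed, hence at most \<open>L\<^sup>2\<close>.\<close>

lemma hdist_le_length:
  assumes "horizontal_curve \<gamma> u v"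
  shows "hdist 0 (\<gamma> 0) (\<gamma> 1) \<le> integral {0..1} (\<lambda>t. sqrt ((u t)\<^sup>2 + (v t)\<^sup>2))"
proof -
  define x y z where xyz: "x = (\<lambda>t. fst (\<gamma> t))" "y = (\<lambda>t. fst (snd (\<gamma> t)))" "z = (\<lambda>t. snd (snd (\<gamma> t)))"
  define w where "w t = - (u t * y t) / 2 + v t * x t / 2" for t
  define L where "L = integral {0..1} (\<lambda>t. sqrt ((u t)\<^sup>2 + (v t)\<^sup>2))"
  have ac: "absolutely_continuous_curve 0 1 \<gamma>" and ae: "AE t in lebesgue_on {0..1}.
        (\<gamma> has_vector_derivative (u t *\<^sub>R heis_X (\<gamma> t) + v t *\<^sub>R heis_Y (\<gamma> t))) (at t)"
    using assms by (auto simp: horizontal_curve_def)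
  have acx: "absolutely_continuous_curve 0 1 x" and acy: "absolutely_continuous_curve 0 1 y"
    and acz: "absolutely_continuous_curve 0 1 z"
    unfolding xyz by (intro absolutely_continuous_curve_compose[OF ac] dist_fst_le
        order_trans[OF dist_fst_le dist_snd_le] order_trans[OF dist_snd_le dist_snd_le])+
  have dx: "AE t in lebesgue_on {0..1}. (x has_vector_derivative u t) (at t)"
    using ae
  proof eventually_elim
    case (elim t)
    from bounded_linear.has_vector_derivative[OF bounded_linear_fst elim]
    show ?case by (simp add: xyz)
  qed
  have dy: "AE t in lebesgue_on {0..1}. (y has_vector_derivative v t) (at t)"
    using ae
  proof eventually_elim
    case (elim t)
    from bounded_linear.has_vector_derivative[OF bounded_linear_fst bounded_linear.has_vector_derivative[OF bounded_linear_snd elim]]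
    show ?case by (simp add: xyz)
  qed
  have dz: "AE t in lebesgue_on {0..1}. (z has_vector_derivative w t) (at t)"
    using ae
  proof eventually_elim
    case (elim t)
    from bounded_linear.has_vector_derivative[OF bounded_linear_snd bounded_linear.has_vector_derivative[OF bounded_linear_snd elim]]
    show ?case by (simp add: xyz w_def)
  qed
  have iu: "u absolutely_integrable_on {0..1}" and iv: "v absolutely_integrable_on {0..1}"
    using absolutely_continuous_absolutely_integrable acx acy dx dy by blast+
  have i0: "(\<lambda>t. sqrt ((u t)\<^sup>2 + (v t)\<^sup>2)) integrable_on {0..1}"
  proof -
    have "(\<lambda>t. sqrt ((u t)\<^sup>2 + (v t)\<^sup>2)) absolutely_integrable_on {0..1}"
    proof (rule measurable_bounded_by_integrable_imp_absolutely_integrable)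
      have m: "u \<in> borel_measurable (lebesgue_on {0..1})" "v \<in> borel_measurable (lebesgue_on {0..1})"
        using iu iv by (auto intro!: integrable_imp_measurable simp: absolutely_integrable_on_def)
      show "(\<lambda>t. sqrt ((u t)\<^sup>2 + (v t)\<^sup>2)) \<in> borel_measurable (lebesgue_on {0..1})"
        using m by measurable
      show "(\<lambda>t. \<bar>u t\<bar> + \<bar>v t\<bar>) integrable_on {0..1}"
        using iu iv by (auto simp: absolutely_integrable_on_def intro: integrable_add)
    qed (auto simp: real_sqrt_sum_squares_triangle_ineq sqrt_sum_squares_le_sum_abs)
    then show ?thesis by (simp add: absolutely_integrable_on_def)
  qed
  have abs1: "\<bar>f t - f 0\<bar> \<le> L"
    if f: "absolutely_continuous_curve 0 1 f" "AE t in lebesgue_on {0..1}. (f has_vector_derivative h t) (at t)"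
      and h: "\<And>t. \<bar>h t\<bar> \<le> sqrt ((u t)\<^sup>2 + (v t)\<^sup>2)" and t: "0 \<le> t" "t \<le> 1" for f h t
  proof -
    have "(h has_integral (f t - f 0)) {0..t}"
    proof (rule absolutely_continuous_has_integral[OF absolutely_continuous_curve_subinterval[OF f(1)]])
      have "AE t in lebesgue. t \<in> {0..1} \<longrightarrow> (f has_vector_derivative h t) (at t)"
        using f(2) by (subst (asm) AE_restrict_space_iff) auto
      then have "AE s in lebesgue. s \<in> {0..t} \<longrightarrow> (f has_vector_derivative h s) (at s)"
        by (rule eventually_mono) (use t in auto)
      then show "AE s in lebesgue_on {0..t}. (f has_vector_derivative h s) (at s)"
        by (subst AE_restrict_space_iff) auto
    qed (use t in auto)
    then have "\<bar>f t - f 0\<bar> = norm (integral {0..t} h)" "h integrable_on {0..t}"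
      by (auto simp: integral_unique intro: has_integral_integrable)
    moreover have i1: "(\<lambda>t. sqrt ((u t)\<^sup>2 + (v t)\<^sup>2)) integrable_on {0..t}"
      using i0 by (rule integrable_on_subinterval) (use t in auto)
    ultimately have "\<bar>f t - f 0\<bar> \<le> integral {0..t} (\<lambda>t. sqrt ((u t)\<^sup>2 + (v t)\<^sup>2))"
      using integral_norm_bound_integral[of h "{0..t}" "\<lambda>t. sqrt ((u t)\<^sup>2 + (v t)\<^sup>2)"] h by simp
    also have "\<dots> \<le> L" unfolding L_def by (rule integral_subset_le) (use i0 i1 t in auto)
    finally show ?thesis .
  qed
  have X: "\<bar>x t - x 0\<bar> \<le> L" if "0 \<le> t" "t \<le> 1" for t
    using abs1[OF acx dx _ that] real_sqrt_ge_abs1 by blast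
  have Y: "\<bar>y t - y 0\<bar> \<le> L" if "0 \<le> t" "t \<le> 1" for t
    using abs1[OF acy dy _ that] real_sqrt_ge_abs2 by blast
  \<comment> \<open>Subtracting \<open>x 0\<close> and \<open>y 0\<close> is left translation of
    \<open>\<gamma> 0\<close> to the identity; only then are the coefficients of \<open>u\<close>
    and \<open>v\<close> bounded by \<open>L\<close>.\<close>
  define k where "k t = ((x t - x 0) * v t - (y t - y 0) * u t) / 2" for t
  have "((\<lambda>t. w t - (x 0 * v t - y 0 * u t) / 2) has_integral
      ((z 1 - z 0) - (x 0 * (y 1 - y 0) - y 0 * (x 1 - x 0)) / 2)) {0..1}"
    using acx acy acz dx dy dz
    by (intro has_integral_diff has_integral_mult_right has_integral_divide absolutely_continuous_has_integral) auto
  also have "(\<lambda>t. w t - (x 0 * v t - y 0 * u t) / 2) = k"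
    by (auto simp: k_def w_def field_simps)
  also have "((z 1 - z 0) - (x 0 * (y 1 - y 0) - y 0 * (x 1 - x 0)) / 2) = heis_height (\<gamma> 0) (\<gamma> 1)"
    by (simp add: heis_height_def xyz field_simps)
  finally have K: "(k has_integral heis_height (\<gamma> 0) (\<gamma> 1)) {0..1}" .
  have "0 \<le> L" using X[of 0] by simp
  have "\<bar>k t\<bar> \<le> L * sqrt ((u t)\<^sup>2 + (v t)\<^sup>2)" if t: "t \<in> {0..1}" for t
  proof -
    let ?s = "sqrt ((u t)\<^sup>2 + (v t)\<^sup>2)"
    have "\<bar>(x t - x 0) * v t\<bar> \<le> L * ?s" "\<bar>(y t - y 0) * u t\<bar> \<le> L * ?s"
      unfolding abs_mult using X[of t] Y[of t] t \<open>0 \<le> L\<close>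
      by (auto intro!: mult_mono real_sqrt_ge_abs1 real_sqrt_ge_abs2)
    then show ?thesis unfolding k_def by (simp only: abs_le_iff diff_divide_distrib) linarith
  qed
  then have "norm (integral {0..1} k) \<le> integral {0..1} (\<lambda>t. L * sqrt ((u t)\<^sup>2 + (v t)\<^sup>2))"
    using K i0 by (intro integral_norm_bound_integral) (auto intro: has_integral_integrable integrable_on_mult_right)
  then have "\<bar>heis_height (\<gamma> 0) (\<gamma> 1)\<bar> \<le> L\<^sup>2"
    using K by (simp add: integral_unique L_def power2_eq_square)
  then have "hdist 0 (\<gamma> 0) (\<gamma> 1) \<le> L"
    using X[of 1] Y[of 1] \<open>0 \<le> L\<close> by (simp add: hdist_le_iff xyz)
  then show ?thesis by (simp add: L_def)
qed

text \<open>
  The curve is the straight segment plus the loops \<open>a (t - t\<^sup>2)\<close> and \<open>b (t - 3 t\<^sup>2 + 2 t\<^sup>3)\<close> in the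
  horizontal coordinates. In left-translated coordinates it ends at height \<open>a (5 Y - b) / 30\<close>,
  whence the choice of \<open>a\<close> and \<open>b\<close>.
\<close>

lemma horizontal_curve_of_short_length:
  obtains \<gamma> u v where "horizontal_curve \<gamma> u v" "\<gamma> 0 = p" "\<gamma> 1 = q"
    "integral {0..1} (\<lambda>t. sqrt ((u t)\<^sup>2 + (v t)\<^sup>2)) \<le> 40 * hdist 0 p q"
proof -
  define M where "M = hdist 0 p q"
  obtain px py pz where p: "p = (px, py, pz)" by (cases p)
  define X Y Z where XYZ: "X = fst q - px" "Y = fst (snd q) - py" "Z = heis_height p q"
  have M0: "0 \<le> M" by (simp add: M_def hdist_nonneg)
  have M: "\<bar>X\<bar> \<le> M" "\<bar>Y\<bar> \<le> M" "\<bar>Z\<bar> \<le> M\<^sup>2"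
    using hdist_le_iff[of 0 M p q] M0 by (auto simp: M_def XYZ p)
  define \<beta> where "\<beta> = sqrt \<bar>Z\<bar>"
  have \<beta>: "0 \<le> \<beta>" "\<beta> \<le> M" "\<beta> * \<beta> = \<bar>Z\<bar>" using M M0 by (auto simp: \<beta>_def real_le_lsqrt)
  \<comment> \<open>Splitting |Z| as \<open>\<beta> * \<beta>\<close> yields
    \<open>a * (5 * Y - b) = 30 * Z\<close> with both loops of size comparable to \<open>M\<close>,
    at most \<open>30 * M\<close> and \<open>6 * M\<close>. The velocity components are then at most
    \<open>31 * M\<close> and \<open>7 * M\<close>, whence the constant 40.\<close>
  define a b where ab: "a = 30 * sgn Z * \<beta>" "b = 5 * Y - \<beta>"
  have a: "\<bar>a\<bar> \<le> 30 * M" using \<beta> by (auto simp: ab abs_mult sgn_if)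
  have b: "\<bar>b\<bar> \<le> 6 * M" using \<beta> M by (auto simp: ab)
  have aZ: "a * (5 * Y - b) = 30 * Z" using \<beta> by (simp add: ab sgn_if)
  define x where "x t = X * t + a * (t - t^2)" for t
  define y where "y t = Y * t + b * (t - 3 * t^2 + 2 * t^3)" for t
  define z where "z t = (X * b * (t^4 - t^3) + a * Y * t^3 / 3 + a * b * (- 2 * t^3 / 3 + t^4 - 2 * t^5 / 5)) / 2" for t
  define u where "u t = X + a * (1 - 2 * t)" for t
  define v where "v t = Y + b * (1 - 6 * t + 6 * t^2)" for t
  define \<gamma> where "\<gamma> t = (px + x t, py + y t, pz + z t + (px * y t - py * x t) / 2)" for t
  have dx: "(x has_real_derivative u t) (at t)" for t
    unfolding x_def u_def by (auto intro!: derivative_eq_intros simp: field_simps)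
  have dy: "(y has_real_derivative v t) (at t)" for t
    unfolding y_def v_def by (auto intro!: derivative_eq_intros simp: field_simps)
  have dz: "(z has_real_derivative ((x t * v t - y t * u t) / 2)) (at t)" for t
  proof -
    have "x t * v t - y t * u t = X * b * (4 * t^3 - 3 * t^2) + a * Y * t^2 + a * b * (- 2 * t^2 + 4 * t^3 - 2 * t^4)"
      unfolding x_def y_def u_def v_def by algebra
    moreover have "(z has_real_derivative ((X * b * (4 * t^3 - 3 * t^2) + a * Y * t^2 + a * b * (- 2 * t^2 + 4 * t^3 - 2 * t^4)) / 2)) (at t)"
      unfolding z_def by (auto intro!: derivative_eq_intros)
    ultimately show ?thesis by simp
  qed
  define D where "D t = (u t, v t, (x t * v t - y t * u t) / 2 + (px * v t - py * u t) / 2)" for t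
  have d\<gamma>: "(\<gamma> has_vector_derivative D t) (at t)" for t
    unfolding \<gamma>_def D_def using dx[of t] dy[of t] dz[of t]
    by (intro has_vector_derivative_Pair; unfold has_real_derivative_iff_has_vector_derivative[symmetric])
       (auto intro!: derivative_eq_intros)
  have D: "D t = u t *\<^sub>R heis_X (\<gamma> t) + v t *\<^sub>R heis_Y (\<gamma> t)" for t
    by (auto simp: D_def \<gamma>_def field_simps)
  have "continuous_on {0..1} D"
    unfolding D_def u_def v_def x_def y_def by (intro continuous_intros) auto
  then have "bounded (D ` {0..1})" by (intro compact_imp_bounded compact_continuous_image) auto
  then obtain B where B: "\<And>t. t \<in> {0..1} \<Longrightarrow> norm (D t) \<le> B" unfolding bounded_iff by blast
  have "absolutely_continuous_curve 0 1 \<gamma>"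
  proof (rule lipschitz_absolutely_continuous_curve[where L=B])
    fix s t :: real assume st: "0 \<le> s" "s \<le> t" "t \<le> 1"
    have "norm (\<gamma> s - \<gamma> t) \<le> B * norm (s - t)"
    proof (rule differentiable_bound[of "{0..1}" \<gamma> "\<lambda>t h. h *\<^sub>R D t"])
      fix r :: real assume r: "r \<in> {0..1}"
      show "(\<gamma> has_derivative (\<lambda>h. h *\<^sub>R D r)) (at r within {0..1})"
        using d\<gamma>[of r] by (auto simp: has_vector_derivative_def intro: has_derivative_at_withinI)
      have "norm (h *\<^sub>R D r) \<le> B * norm h" for h
        using mult_left_mono[OF B[OF r], of "\<bar>h\<bar>"] by (simp add: mult.commute)
      then show "onorm (\<lambda>h. h *\<^sub>R D r) \<le> B" by (rule onorm_le)
    qed (use st in auto)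
    then show "dist (\<gamma> s) (\<gamma> t) \<le> B * (t - s)" using st by (simp add: dist_norm)
  qed
  then have hc: "horizontal_curve \<gamma> u v"
    using d\<gamma> unfolding D by (simp add: horizontal_curve_def)
  have "\<gamma> 0 = p" by (simp add: \<gamma>_def x_def y_def z_def p)
  have "z 1 = a * (5 * Y - b) / 30" by (simp add: z_def field_simps)
  then have "z 1 = Z" using aZ by simp
  moreover have "x 1 = X" "y 1 = Y" by (simp_all add: x_def y_def)
  ultimately have "\<gamma> 1 = (px + X, py + Y, pz + Z + (px * Y - py * X) / 2)" by (simp add: \<gamma>_def)
  also have "\<dots> = q" unfolding XYZ p heis_height_def prod_eq_iff by (simp add: field_simps)
  finally have "\<gamma> 1 = q" .
  have "integral {0..1} (\<lambda>t. sqrt ((u t)\<^sup>2 + (v t)\<^sup>2)) \<le> integral {0..1} (\<lambda>t::real. 40 * M)"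
  proof (rule Henstock_Kurzweil_Integration.integral_le)
    show "(\<lambda>t. sqrt ((u t)\<^sup>2 + (v t)\<^sup>2)) integrable_on {0..1}"
      unfolding u_def v_def by (intro integrable_continuous_interval continuous_intros)
    fix t :: real assume t: "t \<in> {0..1}"
    have "\<bar>1 - 2 * t\<bar> \<le> 1" using t by auto
    then have "\<bar>a * (1 - 2 * t)\<bar> \<le> 30 * M * 1" unfolding abs_mult using a by (intro mult_mono) auto
    then have u: "\<bar>u t\<bar> \<le> 31 * M" unfolding u_def using M by linarith
    have "0 \<le> t * (1 - t)" "0 \<le> (1 - 2 * t)^2" using t by auto
    then have "t - t\<^sup>2 \<ge> 0" "1 - 4 * t + 4 * t\<^sup>2 \<ge> 0"
      by (simp_all add: power2_eq_square algebra_simps)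
    then have "\<bar>1 - 6 * t + 6 * t^2\<bar> \<le> 1" by linarith
    then have "\<bar>b * (1 - 6 * t + 6 * t^2)\<bar> \<le> 6 * M * 1" unfolding abs_mult using b by (intro mult_mono) auto
    then have v: "\<bar>v t\<bar> \<le> 7 * M" unfolding v_def using M by linarith
    show "sqrt ((u t)\<^sup>2 + (v t)\<^sup>2) \<le> 40 * M"
      using sqrt_sum_squares_le_sum_abs[of "u t" "v t"] u v M0 by linarith
  qed auto
  then show ?thesis
    using that[OF hc \<open>\<gamma> 0 = p\<close> \<open>\<gamma> 1 = q\<close>] by (simp add: M_def)
qed

lemma hdist_le_d_cc: "hdist 0 p q \<le> d_cc p q"
  unfolding d_cc_def
proof (rule cInf_greatest)
  obtain \<gamma> u v where "horizontal_curve \<gamma> u v" "\<gamma> 0 = p" "\<gamma> 1 = q"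
    using horizontal_curve_of_short_length by metis
  then show "{integral {0..1} (\<lambda>t. sqrt ((u t)\<^sup>2 + (v t)\<^sup>2)) | \<gamma> u v. horizontal_curve \<gamma> u v \<and> \<gamma> 0 = p \<and> \<gamma> 1 = q} \<noteq> {}"
    by auto
qed (use hdist_le_length in blast)

lemma d_cc_le_hdist: "d_cc p q \<le> 40 * hdist 0 p q"
proof -
  obtain \<gamma> u v where *: "horizontal_curve \<gamma> u v" "\<gamma> 0 = p" "\<gamma> 1 = q"
    "integral {0..1} (\<lambda>t. sqrt ((u t)\<^sup>2 + (v t)\<^sup>2)) \<le> 40 * hdist 0 p q"
    using horizontal_curve_of_short_length by metis
  have "d_cc p q \<le> integral {0..1} (\<lambda>t. sqrt ((u t)\<^sup>2 + (v t)\<^sup>2))"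
    unfolding d_cc_def
  proof (rule cInf_lower)
    show "bdd_below {integral {0..1} (\<lambda>t. sqrt ((u t)\<^sup>2 + (v t)\<^sup>2)) | \<gamma> u v. horizontal_curve \<gamma> u v \<and> \<gamma> 0 = p \<and> \<gamma> 1 = q}"
      by (rule bdd_belowI[of _ "hdist 0 p q"]) (use hdist_le_length in blast)
  qed (use * in blast)
  then show ?thesis using *(4) by linarith
qed

section \<open>Shortcut sites at a single scale\<close>

text \<open>The offsets put both ends of a shortcut on the axis of \<open>tile t (i, j, l)\<close>,
  at one and three quarters of its height, so that balls of radius up to \<open>t / 2\<close> around
  them stay in that tile.\<close>

definition site :: "real \<Rightarrow> int \<Rightarrow> int \<Rightarrow> int \<Rightarrow> heis" where
  "site t i j k = (t * (of_int i + 1 / 2), t * (of_int j + 1 / 2), t\<^sup>2 * (2 * of_int k + 1) / 4)"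

definition shortcut :: "real \<Rightarrow> heis \<Rightarrow> heis \<Rightarrow> bool" where
  "shortcut t a b \<longleftrightarrow> (\<exists>i j l. a = site t i j (2 * l) \<and> b = site t i j (2 * l + 1))"

lemma heis_height_site: "heis_height (site t i j k) (site t i j k') = t\<^sup>2 * of_int (k' - k) / 2"
  by (simp add: heis_height_def site_def field_simps)

lemma hdist_site_vertical:
  "hdist s (site t i j k) (site t i j k') = max 0 (hgauge s (t\<^sup>2 * \<bar>of_int (k' - k)\<bar> / 2))"
  unfolding hdist_def heis_height_site by (simp add: site_def abs_mult)

text \<open>Different columns are at least \<open>t\<close> apart horizontally, and heights within a
  column differ by multiples of \<open>t\<^sup>2 / 2\<close>. The last condition on \<open>c\<close>
  says that \<open>c\<close> is at most the \<open>hdist s\<close> length of this smallest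
  height.\<close>

lemma hdist_site_ge:
  assumes t: "0 < t" and s: "0 \<le> s" and c: "0 < c" "c \<le> t" "c\<^sup>2 + s * c \<le> t\<^sup>2 / 2"
    and ne: "(i, j, k) \<noteq> (i', j', k')"
  shows "c \<le> hdist s (site t i j k) (site t i' j' k')"
proof (rule ccontr)
  assume "\<not> ?thesis"
  then have "hdist s (site t i j k) (site t i' j' k') < c" by simp
  then have *: "\<bar>t * (of_int i' + 1 / 2) - t * (of_int i + 1 / 2)\<bar> < t"
    "\<bar>t * (of_int j' + 1 / 2) - t * (of_int j + 1 / 2)\<bar> < t"
    and h: "\<bar>heis_height (site t i j k) (site t i' j' k')\<bar> < t\<^sup>2 / 2"
    using c s by (auto simp: hdist_less_iff site_def)
  have "m = m'" if "\<bar>t * (of_int m' + 1 / 2) - t * (of_int m + 1 / 2)\<bar> < t" for m m' :: int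
  proof -
    have "t * (of_int m' + 1 / 2) - t * (of_int m + 1 / 2) = t * (of_int m' - of_int m)"
      by (simp add: algebra_simps)
    then have "t * \<bar>of_int m' - of_int m\<bar> < t * 1" using that t by (simp add: abs_mult)
    then have "\<bar>of_int m' - of_int m :: real\<bar> < 1" using t by simp
    then show ?thesis by linarith
  qed
  then have ij: "i' = i" "j' = j" using * by blast+
  then have "k' \<noteq> k" using ne by auto
  then have "1 \<le> \<bar>of_int (k' - k) :: real\<bar>" by linarith
  then have "t\<^sup>2 * 1 \<le> t\<^sup>2 * \<bar>of_int (k' - k)\<bar>" by (intro mult_left_mono) auto
  then show False using h unfolding ij heis_height_site by (simp add: abs_mult)
qed

lemma site_near:
  assumes t: "0 < t"
  obtains i j k where "hdist 0 (site t i j k) y \<le> t"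
proof -
  obtain y1 y2 y3 where y: "y = (y1, y2, y3)" by (cases y)
  define i j where ij: "i = \<lfloor>y1 / t\<rfloor>" "j = \<lfloor>y2 / t\<rfloor>"
  \<comment> \<open>Height of \<open>y\<close> above the level-0 point of the column axis, along
    which sites are \<open>t\<^sup>2 / 2\<close> apart. Rounding leaves an error of at most
    \<open>t / 2\<close> horizontally and \<open>t\<^sup>2 / 4\<close> in height.\<close>
  define h where "h = y3 - (t * (of_int i + 1 / 2) * y2 - t * (of_int j + 1 / 2) * y1) / 2"
  define k where "k = \<lfloor>2 * h / t\<^sup>2\<rfloor>"
  have "of_int i \<le> y1 / t" "y1 / t < of_int i + 1" "of_int j \<le> y2 / t" "y2 / t < of_int j + 1"
    "of_int k \<le> 2 * h / t\<^sup>2" "2 * h / t\<^sup>2 < of_int k + 1"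
    unfolding ij k_def by linarith+
  then have "t * of_int i \<le> y1" "y1 \<le> t * of_int i + t" "t * of_int j \<le> y2" "y2 \<le> t * of_int j + t"
    "t\<^sup>2 * of_int k \<le> 2 * h" "2 * h \<le> t\<^sup>2 * of_int k + t\<^sup>2"
    using t by (simp_all add: field_simps)
  moreover have "heis_height (site t i j k) y = h - (t\<^sup>2 * of_int k) / 2 - t\<^sup>2 / 4"
    by (simp add: heis_height_def site_def y h_def field_simps)
  ultimately have "hdist 0 (site t i j k) y \<le> t"
    using t by (auto simp: hdist_le_iff site_def y abs_le_iff field_simps)
  then show ?thesis by (rule that)
qed

text \<open>Below the scale \<open>t\<close>, a ball meets at most one shortcut.\<close>

lemma separating_function_fine:
  assumes r: "0 < r" "8 * r \<le> t"
  obtains f E where "finite E" "card E \<le> 3" "\<And>p q. \<bar>f p - f q\<bar> \<le> hdist r p q"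
    "\<And>p. 0 \<le> f p \<and> f p \<le> r" "\<And>a b. shortcut t a b \<Longrightarrow> f a = f b" "f x = 0"
    "\<And>y. f y < r \<Longrightarrow> \<exists>e\<in>E. hdist 0 e y < 2 * r"
proof -
  have t: "0 < t" using r by simp
  have "(8 * r)\<^sup>2 \<le> t\<^sup>2" using r by (intro power_mono) auto
  then have "64 * r\<^sup>2 \<le> t\<^sup>2" by simp
  moreover have "0 \<le> r\<^sup>2" by simp
  moreover have "(2 * r)\<^sup>2 + r * (2 * r) = 6 * r\<^sup>2" by (simp add: power2_eq_square)
  ultimately have c: "(2 * r)\<^sup>2 + r * (2 * r) \<le> t\<^sup>2 / 2" by linarith
  have sep: "2 * r \<le> hdist r (site t i j k) (site t i' j' k')" if "(i, j, k) \<noteq> (i', j', k')" for i j k i' j' k'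
    by (rule hdist_site_ge[OF t _ _ _ c that]) (use r in auto)
  \<comment> \<open>\<open>f\<close> will be the distance to \<open>E\<close> cut off at
    \<open>r\<close>, where \<open>E\<close> holds \<open>x\<close> and both ends of the shortcut
    touched by the \<open>r\<close>-ball around \<open>x\<close>, if there is one. By separation
    \<open>f\<close> is then \<open>r\<close> at every site outside \<open>E\<close>.\<close>
  define P where "P a b \<longleftrightarrow> shortcut t a b \<and> (hdist r x a < r \<or> hdist r x b < r)" for a b
  define E where "E = {x} \<union> {w. \<exists>a b. P a b \<and> (w = a \<or> w = b)}"
  have uniq: "(i, j, l) = (i', j', l')"
    if hP: "P (site t i j (2*l)) (site t i j (2*l+1))" "P (site t i' j' (2*l')) (site t i' j' (2*l'+1))" for i j l i' j' l'
  proof (rule ccontr)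
    assume ne: "(i, j, l) \<noteq> (i', j', l')"
    obtain k where k: "k \<in> {2*l, 2*l+1}" "hdist r x (site t i j k) < r" using hP(1) by (auto simp: P_def)
    obtain k' where k': "k' \<in> {2*l', 2*l'+1}" "hdist r x (site t i' j' k') < r" using hP(2) by (auto simp: P_def)
    have "(i, j, k) \<noteq> (i', j', k')" using ne k(1) k'(1) by (auto; presburger)
    from sep[OF this] show False
      using k(2) k'(2) hdist_triangle[of r "site t i j k" "site t i' j' k'" x] r
      by (simp add: hdist_commute[of r x])
  qed
  have E: "finite E \<and> card E \<le> 3"
  proof (cases "\<exists>a b. P a b")
    case True
    then obtain a b where ab: "P a b" by auto
    then obtain i j l where ijl: "a = site t i j (2*l)" "b = site t i j (2*l+1)" by (auto simp: P_def shortcut_def)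
    have "a' = a \<and> b' = b" if P': "P a' b'" for a' b'
    proof -
      obtain i' j' l' where eq: "a' = site t i' j' (2*l')" "b' = site t i' j' (2*l'+1)"
        using P' by (auto simp: P_def shortcut_def)
      have "(i, j, l) = (i', j', l')" by (rule uniq) (use ab P' ijl eq in simp_all)
      then show ?thesis using ijl eq by simp
    qed
    then have "E \<subseteq> {x, a, b}" unfolding E_def by blast
    moreover have "card {x, a, b} \<le> 3" using card_length[of "[x, a, b]"] by simp
    ultimately show ?thesis
      using card_mono[of "{x, a, b}" E] finite_subset[of E "{x, a, b}"] by simp
  next
    case False
    then have "E = {x}" by (auto simp: E_def)
    then show ?thesis by simp
  qed
  define f where "f y = Min (insert r ((\<lambda>e. hdist r e y) ` E))" for y
  have fin: "finite (insert r ((\<lambda>e. hdist r e y) ` E))" for y using E by auto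
  have f_le: "f p \<le> f q + hdist r p q" for p q
  proof -
    have "f q \<in> insert r ((\<lambda>e. hdist r e q) ` E)" unfolding f_def by (rule Min_in[OF fin]) auto
    then consider "f q = r" | e where "e \<in> E" "f q = hdist r e q" by auto
    then show ?thesis
    proof cases
      case 1
      have "f p \<le> r" unfolding f_def by (rule Min_le[OF fin]) auto
      then show ?thesis using 1 hdist_nonneg[of r p q] by linarith
    next
      case 2
      have "f p \<le> hdist r e p" unfolding f_def by (rule Min_le[OF fin]) (use 2 in auto)
      then show ?thesis using 2 hdist_triangle[of r e p q] r by (simp add: hdist_commute[of r q p])
    qed
  qed
  have 1: "\<bar>f p - f q\<bar> \<le> hdist r p q" for p q
    using f_le[of p q] f_le[of q p] by (simp add: hdist_commute[of r q p])
  have 2: "0 \<le> f p \<and> f p \<le> r" for p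
    unfolding f_def using E r by (auto simp: hdist_nonneg)
  have 0: "f e = 0" if "e \<in> E" for e
  proof -
    have "f e \<le> hdist r e e" unfolding f_def by (rule Min_le[OF fin]) (use that in auto)
    then show ?thesis using 2[of e] r by simp
  qed
  have far: "f w = r" if w: "w = site t i j k" "w \<notin> E" for w i j k
  proof -
    have "r \<le> hdist r e w" if e: "e \<in> E" for e
    proof (cases "e = x")
      case True
      have "\<not> P (site t i j (2 * (k div 2))) (site t i j (2 * (k div 2) + 1))"
      proof
        assume "P (site t i j (2 * (k div 2))) (site t i j (2 * (k div 2) + 1))"
        then have "site t i j (2 * (k div 2)) \<in> E" "site t i j (2 * (k div 2) + 1) \<in> E"
          unfolding E_def by blast+
        moreover have "k = 2 * (k div 2) \<or> k = 2 * (k div 2) + 1" by presburger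
        ultimately show False using w by metis
      qed
      moreover have "shortcut t (site t i j (2 * (k div 2))) (site t i j (2 * (k div 2) + 1))"
        by (auto simp: shortcut_def)
      moreover have "k = 2 * (k div 2) \<or> k = 2 * (k div 2) + 1" by presburger
      ultimately have "\<not> hdist r x w < r" unfolding P_def w(1) by metis
      then show ?thesis using True by simp
    next
      case False
      then obtain a b where ab: "P a b" "e = a \<or> e = b" using e False unfolding E_def by blast
      then obtain i' j' l where ijl: "a = site t i' j' (2*l)" "b = site t i' j' (2*l+1)"
        by (auto simp: P_def shortcut_def)
      obtain k' where k': "e = site t i' j' k'" using ab ijl by auto
      have "w \<noteq> e" using w e by auto
      then have "(i', j', k') \<noteq> (i, j, k)" using w k' by auto
      from sep[OF this] show ?thesis using r k' w by simp
    qed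
    then show ?thesis unfolding f_def
      using E r by (intro Min_eqI) auto
  qed
  have 3: "f a = f b" if ab: "shortcut t a b" for a b
  proof (cases "P a b")
    case True
    then have "a \<in> E" "b \<in> E" unfolding E_def by blast+
    then show ?thesis using 0 by simp
  next
    case False
    obtain i j l where ijl: "a = site t i j (2*l)" "b = site t i j (2*l+1)" using ab by (auto simp: shortcut_def)
    \<comment> \<open>An end of an untouched shortcut cannot lie in \<open>E\<close>: it is not
      \<open>x\<close>, and by separation it is not an end of the touched shortcut.\<close>
    have out: "f w = r" if w: "w = a \<or> w = b" for w
    proof (cases "w \<in> E")
      case False
      then show ?thesis using far w ijl by blast
    next
      case True
      show ?thesis
      proof (cases "w = x")
        case True
        then have "hdist r x w < r" using r by simp
        then show ?thesis using w ab \<open>\<not> P a b\<close> by (auto simp: P_def)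
      next
        case False
        then obtain a' b' where *: "P a' b'" "w = a' \<or> w = b'" using True False unfolding E_def by blast
        then obtain i' j' l' where ijl': "a' = site t i' j' (2*l')" "b' = site t i' j' (2*l'+1)"
          by (auto simp: P_def shortcut_def)
        obtain k where k: "k \<in> {2*l, 2*l+1}" "w = site t i j k" using w ijl by auto
        obtain k' where k': "k' \<in> {2*l', 2*l'+1}" "w = site t i' j' k'" using * ijl' by auto
        have "(i, j, k) = (i', j', k')" using sep[of i j k i' j' k'] k k' r by fastforce
        then have "i = i'" "j = j'" "l = l'" using k k' by (auto; presburger)+
        then show ?thesis using *(1) \<open>\<not> P a b\<close> ijl ijl' by simp
      qed
    qed
    then show ?thesis by simp
  qed
  have 4: "\<exists>e\<in>E. hdist 0 e y < 2 * r" if y: "f y < r" for y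
  proof -
    obtain e where e: "e \<in> E" "hdist r e y < r" using y E fin unfolding f_def by (auto simp: Min_less_iff)
    \<comment> \<open>An \<open>hdist r\<close> distance below \<open>r\<close> permits heights
      below \<open>2 * r\<^sup>2\<close>, so the return to \<open>hdist 0\<close> costs at most a
      factor 2.\<close>
    have "r\<^sup>2 + r * r \<le> (2 * r)\<^sup>2" by (simp add: power2_eq_square)
    then have "hdist 0 e y < 2 * r"
      using e r by (auto simp: hdist_less_iff)
    then show ?thesis using e by auto
  qed
  show ?thesis
    by (rule that[of E f]) (use E 1 2 3 4 0[of x] in \<open>auto simp: E_def\<close>)
qed

text \<open>
  Above the scale \<open>t\<close>, prescribe at both ends of each shortcut the smaller of the two values of
  \<open>hdist r x\<close> and extend \<^emph>\<open>a la\<close> McShane. The two ends are only \<open>t\<^sup>2 / r\<close> apart for \<open>hdist r\<close>, so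
  little is lost.
\<close>

lemma separating_function_coarse:
  assumes t: "0 < t" "10 * t \<le> r"
  obtains f where "\<And>p q. \<bar>f p - f q\<bar> \<le> 2 * hdist r p q"
    "\<And>p. 0 \<le> f p \<and> f p \<le> r + 2 * t" "\<And>a b. shortcut t a b \<Longrightarrow> f a = f b" "f x \<le> 3 * t"
    "\<And>y. f y < r - t \<Longrightarrow> hdist 0 x y < 2 * r"
proof -
  have r: "0 < r" using t by simp
  define st :: "int \<times> int \<times> int \<Rightarrow> heis" where "st = (\<lambda>(i, j, k). site t i j k)"
  define pt :: "int \<times> int \<times> int \<Rightarrow> int \<times> int \<times> int" where
    "pt = (\<lambda>(i, j, k). (i, j, if even k then k + 1 else k - 1))"
  \<comment> \<open>\<open>\<kappa>\<close> is the \<open>hdist r\<close> length of a shortcut and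
    at the same time a lower bound for the distance of any two distinct sites.\<close>
  define \<kappa> where "\<kappa> = hgauge r (t\<^sup>2 / 2)"
  define g where "g y = min r (hdist r x y)" for y
  define G where "G w = min (g (st w)) (g (st (pt w)))" for w
  define f where "f y = (INF w. G w + 2 * hdist r (st w) y)" for y
  have \<kappa>_le: "\<kappa> \<le> t" unfolding \<kappa>_def using t r by (subst hgauge_le_iff) (auto simp: field_simps intro: add_increasing2)
  have \<kappa>0: "0 < \<kappa>" using t unfolding \<kappa>_def hgauge_def by (simp add: real_less_rsqrt)
  have \<kappa>eq: "\<kappa>\<^sup>2 + r * \<kappa> \<le> t\<^sup>2 / 2"
  proof -
    have "(sqrt (r\<^sup>2 + 2 * t\<^sup>2))\<^sup>2 = r\<^sup>2 + 2 * t\<^sup>2" by simp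
    moreover have "sqrt (r\<^sup>2 + 2 * t\<^sup>2) = 2 * \<kappa> + r" by (simp add: \<kappa>_def hgauge_def diff_divide_distrib)
    ultimately have "(2 * \<kappa> + r)\<^sup>2 = r\<^sup>2 + 2 * t\<^sup>2" by simp
    then show ?thesis by (simp add: power2_eq_square algebra_simps)
  qed
  have pt: "hdist r (st w) (st (pt w)) \<le> \<kappa>" "pt (pt w) = w" for w
    using \<kappa>0 by (auto simp: st_def pt_def \<kappa>_def hdist_site_vertical split: prod.splits)
  have sep: "\<kappa> \<le> hdist r (st w) (st w')" if "w \<noteq> w'" for w w'
    using hdist_site_ge[OF t(1) _ \<kappa>0 \<kappa>_le \<kappa>eq] that r
    by (cases w; cases w') (simp add: st_def)
  have g_lip: "g p \<le> g q + hdist r p q" for p q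
    using hdist_triangle[of r x p q] hdist_nonneg[of r p q] r
    by (auto simp: g_def hdist_commute[of r q p])
  have g0: "0 \<le> g y" "g y \<le> r" for y using r by (auto simp: g_def hdist_nonneg)
  have G0: "0 \<le> G w" "G w \<le> r" for w using g0 by (auto simp: G_def min_le_iff_disj)
  have bdd: "bdd_below (range (\<lambda>w. G w + 2 * hdist r (st w) y))" for y
    by (rule bdd_belowI[of _ 0]) (use G0 in \<open>auto intro!: add_nonneg_nonneg hdist_nonneg\<close>)
  have f_le: "f y \<le> G w + 2 * hdist r (st w) y" for w y
    unfolding f_def by (rule cINF_lower[OF bdd]) auto
  have f_ge: "c \<le> f y" if "\<And>w. c \<le> G w + 2 * hdist r (st w) y" for c y
    unfolding f_def by (rule cINF_greatest) (use that in auto)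
  have Gw: "\<exists>w'. G w = g (st w') \<and> hdist r (st w') (st w) \<le> \<kappa>" for w
  proof (cases "g (st w) \<le> g (st (pt w))")
    case True
    then show ?thesis using \<kappa>0 r by (intro exI[of _ w]) (auto simp: G_def)
  next
    case False
    then show ?thesis using pt by (intro exI[of _ "pt w"]) (auto simp: G_def hdist_commute[of r "st (pt w)"])
  qed
  have near: "\<exists>w. hdist r (st w) y \<le> t" for y
  proof -
    obtain i j k where "hdist 0 (site t i j k) y \<le> t" using site_near[OF t(1)] by blast
    then have "hdist r (site t i j k) y \<le> t" using hdist_antimono[of r "site t i j k" y] r by linarith
    then show ?thesis by (intro exI[of _ "(i, j, k)"]) (simp add: st_def)
  qed
  have val: "f (st w) = G w" for w
  proof (rule antisym)
    show "f (st w) \<le> G w" using f_le[of "st w" w] r by simp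
    show "G w \<le> f (st w)"
    proof (rule f_ge)
      \<comment> \<open>The value at \<open>w'\<close> is that of \<open>g\<close> at a site within
        \<open>\<kappa>\<close>, and \<open>\<kappa>\<close> is at most the distance from
        \<open>w'\<close> to \<open>w\<close>. Hence \<open>G\<close> is 2-Lipschitz on the sites,
        and the McShane extension with constant 2 attains it.\<close>
      fix w' show "G w \<le> G w' + 2 * hdist r (st w') (st w)"
      proof (cases "w' = w")
        case False
        obtain v where v: "G w' = g (st v)" "hdist r (st v) (st w') \<le> \<kappa>" using Gw by blast
        have "G w \<le> g (st w)" by (simp add: G_def)
        also have "\<dots> \<le> g (st v) + hdist r (st w) (st v)" by (rule g_lip)
        also have "hdist r (st w) (st v) \<le> hdist r (st v) (st w') + hdist r (st w') (st w)"
          using hdist_triangle[of r "st v" "st w" "st w'"] r by (simp add: hdist_commute[of r "st w" "st v"])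
        finally show ?thesis using v sep[OF False] by simp
      qed (use r in simp)
    qed
  qed
  have lip: "f p \<le> f q + 2 * hdist r p q" for p q
  proof -
    have "f p - 2 * hdist r p q \<le> f q"
    proof (rule f_ge)
      fix w
      show "f p - 2 * hdist r p q \<le> G w + 2 * hdist r (st w) q"
        using f_le[of p w] hdist_triangle[of r "st w" p q] r by (simp add: hdist_commute[of r q p])
    qed
    then show ?thesis by simp
  qed
  have lower: "g y - \<kappa> \<le> f y" for y
  proof (rule f_ge)
    fix w
    obtain v where v: "G w = g (st v)" "hdist r (st v) (st w) \<le> \<kappa>" using Gw by blast
    have "g y \<le> g (st v) + hdist r y (st v)" by (rule g_lip)
    also have "hdist r y (st v) \<le> hdist r y (st w) + hdist r (st w) (st v)" using r by (simp add: hdist_triangle)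
    finally show "g y - \<kappa> \<le> G w + 2 * hdist r (st w) y"
      using v hdist_nonneg[of r y "st w"] by (simp add: hdist_commute[of r "st w"])
  qed
  show ?thesis
  proof (rule that[of f])
    show "\<bar>f p - f q\<bar> \<le> 2 * hdist r p q" for p q
      using lip[of p q] lip[of q p] by (simp add: hdist_commute[of r q p])
    show "0 \<le> f p \<and> f p \<le> r + 2 * t" for p
    proof
      show "0 \<le> f p" by (rule f_ge) (use G0 in \<open>auto intro!: add_nonneg_nonneg hdist_nonneg\<close>)
      obtain w where "hdist r (st w) p \<le> t" using near by blast
      then show "f p \<le> r + 2 * t" using f_le[of p w] G0(2)[of w] by linarith
    qed
    show "f a = f b" if "shortcut t a b" for a b
    proof -
      obtain i j l where "a = st (i, j, 2*l)" "b = st (i, j, 2*l+1)"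
        using \<open>shortcut t a b\<close> by (auto simp: shortcut_def st_def)
      moreover have "pt (i, j, 2*l) = (i, j, 2*l+1)" by (simp add: pt_def)
      ultimately obtain w where w: "a = st w" "b = st (pt w)" by metis
      show ?thesis unfolding w val by (simp add: G_def pt min.commute)
    qed
    obtain w where w: "hdist r (st w) x \<le> t" using near by blast
    have "G w \<le> g (st w)" by (simp add: G_def)
    also have "\<dots> \<le> hdist r x (st w)" by (simp add: g_def)
    finally show "f x \<le> 3 * t" using f_le[of x w] w by (simp add: hdist_commute[of r x])
    show "hdist 0 x y < 2 * r" if "f y < r - t" for y
    proof -
      have "g y < r" using lower[of y] that \<kappa>_le by linarith
      then have *: "hdist r x y < r" by (simp add: g_def min_def split: if_splits)
      have "r\<^sup>2 + r * r \<le> (2 * r)\<^sup>2" by (simp add: power2_eq_square)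
      then show ?thesis using * r by (auto simp: hdist_less_iff)
    qed
  qed
qed

section \<open>The shortcut distance\<close>

definition level_scale :: "nat \<Rightarrow> real" where
  "level_scale n = (1 / 2) ^ (n * n)"

definition level_cost :: "nat \<Rightarrow> real" where
  "level_cost n = (1 / 2) ^ (n * n + n)"

definition admissible :: "(heis \<Rightarrow> real) \<Rightarrow> bool" where
  "admissible f \<longleftrightarrow> (\<forall>p q. f p - f q \<le> hdist 0 p q) \<and>
     (\<forall>n a b. shortcut (level_scale n) a b \<longrightarrow> \<bar>f a - f b\<bar> \<le> level_cost n)"

text \<open>This is the largest pseudo-distance that is at most \<open>hdist 0\<close> and at most
  \<open>level_cost n\<close> across each shortcut of level \<open>n\<close>: any such
  \<open>\<rho>\<close> provides the admissible functions
  \<open>\<lambda>p. \<rho> p q\<close>.\<close>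

definition sdist :: "heis \<Rightarrow> heis \<Rightarrow> real" where
  "sdist p q = (SUP f\<in>Collect admissible. f p - f q)"

lemma level_scale_pos [simp]: "0 < level_scale n" and level_cost_pos [simp]: "0 < level_cost n"
  by (simp_all add: level_scale_def level_cost_def)

lemma level_cost_le_scale: "level_cost n \<le> level_scale n"
  unfolding level_cost_def level_scale_def by (intro power_decreasing) auto

lemma level_cost_eq: "level_cost n = (1 / 2) ^ n * level_scale n"
  by (simp add: level_cost_def level_scale_def power_add)

lemma level_cost_antimono: "m \<le> n \<Longrightarrow> level_cost n \<le> level_cost m"
  unfolding level_cost_def by (intro power_decreasing add_mono mult_mono) auto

lemma level_scale_le_cost: "m < n \<Longrightarrow> level_scale n \<le> level_cost m"
proof -
  assume "m < n"
  then have "m * Suc m \<le> n * n" by (intro mult_mono) auto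
  then have "m * m + m \<le> n * n" by simp
  then show ?thesis unfolding level_cost_def level_scale_def by (intro power_decreasing) auto
qed

text \<open>For consecutive levels this is an equality: \<open>2 * (k + 1)\<^sup>2\<close> is the
  sum of the exponents \<open>k * k + k\<close> and \<open>(k + 1) * (k + 1) + (k + 1)\<close>. It
  makes finer shortcuts harmless for the test functions.\<close>

lemma level_scale_square_le: "m < n \<Longrightarrow> (level_scale n)\<^sup>2 \<le> level_cost m * level_cost n"
proof -
  assume "m < n"
  then obtain k where n: "n = Suc k" "m \<le> k" by (cases n) auto
  have "(level_scale n)\<^sup>2 = level_cost k * level_cost n"
    unfolding level_scale_def level_cost_def n power_mult[symmetric] power_add[symmetric] by (rule arg_cong) simp
  then show ?thesis using level_cost_antimono[OF n(2)] by (simp add: mult_right_mono)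
qed

lemma level_scale_tendsto_0: "level_scale \<longlonglongrightarrow> 0"
proof (rule tendsto_sandwich[of "\<lambda>_. 0" _ _ "\<lambda>n. (1 / 2) ^ n"])
  show "\<forall>\<^sub>F n in sequentially. level_scale n \<le> (1 / 2) ^ n"
    unfolding level_scale_def by (intro always_eventually allI power_decreasing) auto
qed (auto intro: LIMSEQ_realpow_zero always_eventually simp: less_imp_le)

lemma admissibleD: "admissible f \<Longrightarrow> f p - f q \<le> hdist 0 p q"
  unfolding admissible_def by blast

lemma admissible_zero: "admissible (\<lambda>_. 0)"
  by (simp add: admissible_def hdist_nonneg less_imp_le)

lemma admissible_uminus: "admissible f \<Longrightarrow> admissible (\<lambda>p. - f p)"
  unfolding admissible_def by (metis abs_minus_commute hdist_commute minus_diff_minus minus_diff_eq add_uminus_conv_diff)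

lemma sdist_bdd: "bdd_above ((\<lambda>f. f p - f q) ` Collect admissible)"
  by (rule bdd_aboveI[of _ "hdist 0 p q"]) (auto intro: admissibleD)

lemma sdist_ge: "admissible f \<Longrightarrow> f p - f q \<le> sdist p q"
  unfolding sdist_def by (rule cSUP_upper[OF _ sdist_bdd]) auto

lemma sdist_leI: "(\<And>f. admissible f \<Longrightarrow> f p - f q \<le> c) \<Longrightarrow> sdist p q \<le> c"
  unfolding sdist_def by (rule cSUP_least) (use admissible_zero in auto)

lemma sdist_le_hdist: "sdist p q \<le> hdist 0 p q"
  by (intro sdist_leI admissibleD)

lemma sdist_shortcut: "shortcut (level_scale n) a b \<Longrightarrow> sdist a b \<le> level_cost n"
  by (rule sdist_leI) (metis abs_le_iff admissible_def)

lemma sdist_nonneg: "0 \<le> sdist p q"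
  using sdist_ge[OF admissible_zero, of p q] by simp

lemma sdist_commute: "sdist p q = sdist q p"
proof -
  have "sdist p q \<le> sdist q p" for p q
    by (rule sdist_leI) (use sdist_ge[OF admissible_uminus, of _ q p] in simp)
  then show ?thesis by (simp add: antisym)
qed

lemma sdist_triangle: "sdist p r \<le> sdist p q + sdist q r"
proof (rule sdist_leI)
  fix f assume "admissible f"
  from sdist_ge[OF this, of p q] sdist_ge[OF this, of q r]
  show "f p - f r \<le> sdist p q + sdist q r" by simp
qed

text \<open>
  A function of size \<open>r\<close> is cheap on the shortcuts of coarser levels, which cost at least \<open>r\<close>; being
  Lipschitz for \<open>hdist s\<close> with \<open>r \<le> s\<close>, it varies so little in the vertical direction that it is
  cheap on the shortcuts of finer levels as well.
\<close>

lemma admissibleI: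
  assumes lip: "\<And>p q. \<bar>f p - f q\<bar> \<le> hdist s p q" and r: "0 < r" "r \<le> s"
    and bound: "\<And>p. 0 \<le> f p \<and> f p \<le> r"
    and n: "level_cost n \<le> r" "\<And>m. m < n \<Longrightarrow> r \<le> level_cost m"
    and level: "\<And>a b. shortcut (level_scale n) a b \<Longrightarrow> f a = f b"
  shows "admissible f"
  unfolding admissible_def
proof (intro conjI allI impI)
  fix p q show "f p - f q \<le> hdist 0 p q"
    using lip[of p q] hdist_antimono[of s p q] r by linarith
next
  fix m a b assume ab: "shortcut (level_scale m) a b"
  consider "m < n" | "m = n" | "n < m" by linarith
  then show "\<bar>f a - f b\<bar> \<le> level_cost m"
  proof cases
    case 1
    then show ?thesis using bound[of a] bound[of b] n(2)[OF 1] by linarith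
  next
    case 2
    then show ?thesis using level ab by (simp add: less_imp_le)
  next
    case 3
    have s: "0 < s" using r by simp
    obtain i j l where "a = site (level_scale m) i j (2*l)" "b = site (level_scale m) i j (2*l+1)"
      using ab by (auto simp: shortcut_def)
    then have "hdist s a b = max 0 (hgauge s ((level_scale m)\<^sup>2 / 2))" by (simp add: hdist_site_vertical)
    also have "\<dots> \<le> (level_scale m)\<^sup>2 / 2 / s"
      using s hgauge_le_divide[of s "(level_scale m)\<^sup>2 / 2"] by simp
    also have "\<dots> \<le> level_cost n * level_cost m / s"
      using level_scale_square_le[OF 3] s zero_le_power2[of "level_scale m"]
      by (intro divide_right_mono) linarith+
    also have "\<dots> \<le> s * level_cost m / s" using s n r by (intro divide_right_mono mult_right_mono) (auto simp: less_imp_le)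
    also have "\<dots> = level_cost m" using s by simp
    finally show ?thesis using lip[of a b] by linarith
  qed
qed

text \<open>When the critical scale is at most \<open>8 * r\<close>, its shortcuts move points by a
  multiple of \<open>r\<close> only, so one homogeneous ball around \<open>x\<close> suffices. The
  radius \<open>80 * r\<close> is ten times the largest scale allowed.\<close>

lemma sdist_ball_coarse:
  assumes t: "level_scale n \<le> 8 * r" and n: "level_cost n \<le> r" "\<And>m. m < n \<Longrightarrow> r \<le> level_cost m"
    and xy: "sdist x y < r / 8"
  shows "hdist 0 x y < 160 * r"
proof -
  have r: "0 < r" using t level_scale_pos[of n] by linarith
  obtain f where f: "\<And>p q. \<bar>f p - f q\<bar> \<le> 2 * hdist (80 * r) p q"
    "\<And>p. 0 \<le> f p \<and> f p \<le> 80 * r + 2 * level_scale n" "\<And>a b. shortcut (level_scale n) a b \<Longrightarrow> f a = f b"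
    "f x \<le> 3 * level_scale n" "\<And>y. f y < 80 * r - level_scale n \<Longrightarrow> hdist 0 x y < 2 * (80 * r)"
    using separating_function_coarse[of "level_scale n" "80 * r" x] t by auto
  \<comment> \<open>The values of \<open>f\<close> are at most \<open>80 * r + 16 * r\<close>, so
    128 brings them below \<open>r\<close> and the Lipschitz constant 2 below 1. Conversely
    \<open>r / 8\<close> becomes \<open>16 * r\<close>, and \<open>f x\<close> is at most
    \<open>24 * r\<close>, so \<open>f y\<close> stays below \<open>80 * r - 8 * r\<close>.\<close>
  define F where "F p = f p / 128" for p
  have "admissible F"
  proof (rule admissibleI[where s="80 * r" and r=r and n=n])
    fix p q
    have "\<bar>F p - F q\<bar> = \<bar>f p - f q\<bar> / 128" by (simp add: F_def flip: diff_divide_distrib)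
    also have "\<dots> \<le> 2 * hdist (80 * r) p q / 128" using f(1) by (intro divide_right_mono) auto
    also have "\<dots> \<le> hdist (80 * r) p q" using hdist_nonneg[of "80 * r" p q] by simp
    finally show "\<bar>F p - F q\<bar> \<le> hdist (80 * r) p q" .
  next
    fix p show "0 \<le> F p \<and> F p \<le> r" using f(2)[of p] t by (auto simp: F_def)
  qed (use r n f(3) in \<open>auto simp: F_def\<close>)
  from sdist_ge[OF this, of y x] have "f y - f x < 16 * r"
    using xy by (simp add: F_def sdist_commute[of y x])
  then have "f y < 80 * r - level_scale n" using f(4) t r by linarith
  then show ?thesis using f(5) by simp
qed

text \<open>The radius \<open>level_scale n\<close> lies between the cost of level \<open>n\<close>
  and the costs of all coarser levels. These radii tend to 0, which gives definiteness of
  \<open>sdist\<close>.\<close>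

lemma sdist_ball_scale:
  "sdist x y < level_scale n / 8 \<Longrightarrow> hdist 0 x y < 160 * level_scale n"
  by (rule sdist_ball_coarse[of n "level_scale n"]) (use level_cost_le_scale level_scale_le_cost level_scale_pos[of n] in auto)

lemma sdist_eq_0_iff: "sdist x y = 0 \<longleftrightarrow> x = y"
proof
  assume "sdist x y = 0"
  then have *: "hdist 0 x y < 160 * level_scale n" for n by (intro sdist_ball_scale) simp
  have "(\<lambda>n. 160 * level_scale n) \<longlonglongrightarrow> 160 * 0" by (intro tendsto_mult tendsto_const level_scale_tendsto_0)
  then have "hdist 0 x y \<le> 160 * 0"
    by (rule LIMSEQ_le_const) (use * in \<open>auto intro: less_imp_le\<close>)
  then show "x = y" using hdist_nonneg[of 0 x y] hdist_eq_0_iff by simp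
next
  assume "x = y"
  then show "sdist x y = 0" using sdist_le_hdist[of x y] sdist_nonneg[of x y] by simp
qed

lemma Metric_space_sdist: "Metric_space UNIV sdist"
  by unfold_locales (auto simp: sdist_nonneg sdist_eq_0_iff sdist_triangle intro: sdist_commute)

text \<open>The critical level is the first one with cost at most \<open>R\<close>. If its scale is
  at least \<open>8 * R\<close>, the ball sees at most one shortcut, whose ends join
  \<open>x\<close> in \<open>E\<close>; otherwise \<open>x\<close> alone suffices.\<close>

lemma sdist_ball:
  assumes r: "0 < r"
  obtains E where "finite E" "card E \<le> 3" "\<And>y. sdist x y < r \<Longrightarrow> \<exists>e\<in>E. hdist 0 e y < 1280 * r"
proof -
  \<comment> \<open>The coarse case controls only \<open>sdist\<close> below an eighth of its
    radius; \<open>1280 = 160 * 8\<close>.\<close>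
  define R where "R = 8 * r"
  have R: "0 < R" using r by (simp add: R_def)
  have "\<exists>n. level_cost n < R"
  proof -
    from order_tendstoD(2)[OF level_scale_tendsto_0 R] obtain n where "level_scale n < R"
      by (auto simp: eventually_sequentially)
    then show ?thesis using level_cost_le_scale[of n] by (intro exI[of _ n]) linarith
  qed
  define n where "n = (LEAST n. level_cost n \<le> R)"
  have n: "level_cost n \<le> R"
    unfolding n_def by (rule LeastI_ex) (use \<open>\<exists>n. level_cost n < R\<close> in \<open>auto intro: less_imp_le\<close>)
  have n': "R \<le> level_cost m" if "m < n" for m
    using not_less_Least[of m "\<lambda>n. level_cost n \<le> R"] that unfolding n_def by simp
  show ?thesis
  proof (cases "8 * R \<le> level_scale n")
    case True
    obtain f E where f: "finite E" "card E \<le> 3" "\<And>p q. \<bar>f p - f q\<bar> \<le> hdist R p q"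
    "\<And>p. 0 \<le> f p \<and> f p \<le> R" "\<And>a b. shortcut (level_scale n) a b \<Longrightarrow> f a = f b" "f x = 0"
    "\<And>y. f y < R \<Longrightarrow> \<exists>e\<in>E. hdist 0 e y < 2 * R"
      by (rule separating_function_fine[OF R True, of x]) blast
    have "admissible f" by (rule admissibleI[OF f(3) R order_refl f(4) n n' f(5)])
    show ?thesis
    proof (rule that[OF f(1,2)])
      fix y assume "sdist x y < r"
      then have "f y < R" using sdist_ge[OF \<open>admissible f\<close>, of y x] f(6) r
        by (simp add: sdist_commute[of y x] R_def)
      from f(7)[OF this] obtain e where "e \<in> E" "hdist 0 e y < 2 * R" by blast
      then show "\<exists>e\<in>E. hdist 0 e y < 1280 * r" using r by (intro bexI[of _ e]) (simp_all add: R_def)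
    qed
  next
    case False
    show ?thesis
    proof (rule that[of "{x}"])
      fix y assume "sdist x y < r"
      then show "\<exists>e\<in>{x}. hdist 0 e y < 1280 * r"
        using sdist_ball_coarse[of n R x y] False n n' by (auto simp: R_def)
    qed auto
  qed
qed

section \<open>Heisenberg boxes, Lebesgue measure and tilings\<close>

text \<open>The left translate by \<open>p\<close> of the Euclidean product of \<open>I\<close>,
  \<open>J\<close> and \<open>K\<close>.\<close>

definition hbox :: "heis \<Rightarrow> real set \<Rightarrow> real set \<Rightarrow> real set \<Rightarrow> heis set" where
  "hbox p I J K = {q. fst q - fst p \<in> I \<and> fst (snd q) - fst (snd p) \<in> J \<and> heis_height p q \<in> K}"

lemma emeasure_lborel_shift:
  fixes K :: "real set"
  assumes K[measurable]: "K \<in> sets borel"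
  shows "emeasure lborel {z. z - c \<in> K} = emeasure lborel K"
proof -
  have "emeasure lborel K = emeasure (distr lborel borel ((+) (- c))) K"
    by (simp add: lborel_distr_plus)
  also have "\<dots> = emeasure lborel ((+) (- c) -` K \<inter> space lborel)" by (rule emeasure_distr) auto
  also have "(+) (- c) -` K \<inter> space lborel = {z. z - c \<in> K}" by auto
  finally show ?thesis by simp
qed

lemma emeasure_lborel_fibers:
  fixes S :: "(real \<times> 'a::euclidean_space) set"
  assumes S: "S \<in> sets borel" and I: "I \<in> sets borel"
    and fib: "\<And>x. x \<in> I \<Longrightarrow> emeasure lborel (Pair x -` S) = c" "\<And>x. x \<notin> I \<Longrightarrow> Pair x -` S = {}"
  shows "emeasure lborel S = emeasure lborel I * c"
proof -
  have "emeasure lborel S = emeasure (lborel \<Otimes>\<^sub>M lborel) S" by (simp add: lborel_prod)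
  also have "\<dots> = (\<integral>\<^sup>+x. emeasure lborel (Pair x -` S) \<partial>lborel)"
    by (rule lborel.emeasure_pair_measure_alt) (use S in \<open>metis lborel_prod sets_lborel\<close>)
  also have "\<dots> = (\<integral>\<^sup>+x. c * indicator I x \<partial>lborel)"
    by (rule nn_integral_cong) (auto simp: fib indicator_def)
  also have "\<dots> = c * emeasure lborel I" using I by (simp add: nn_integral_cmult_indicator)
  finally show ?thesis by (simp add: mult.commute)
qed

lemma borel_hbox:
  assumes "I \<in> sets borel" "J \<in> sets borel" "K \<in> sets borel"
  shows "hbox p I J K \<in> sets borel"
proof -
  have "(\<lambda>q::heis. fst q - fst p) \<in> borel_measurable borel"
    "(\<lambda>q::heis. fst (snd q) - fst (snd p)) \<in> borel_measurable borel"
    "heis_height p \<in> borel_measurable borel"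
    unfolding heis_height_def by (auto intro!: borel_measurable_continuous_onI continuous_intros)
  then have "(\<lambda>q::heis. fst q - fst p) -` I \<inter> space borel \<in> sets borel"
    "(\<lambda>q::heis. fst (snd q) - fst (snd p)) -` J \<inter> space borel \<in> sets borel"
    "heis_height p -` K \<inter> space borel \<in> sets borel"
    using assms by (blast intro: measurable_sets)+
  moreover have "hbox p I J K = ((\<lambda>q::heis. fst q - fst p) -` I \<inter> space borel) \<inter>
    ((\<lambda>q::heis. fst (snd q) - fst (snd p)) -` J \<inter> space borel) \<inter> (heis_height p -` K \<inter> space borel)"
    by (auto simp: hbox_def)
  ultimately show ?thesis by (metis sets.Int)
qed

text \<open>For fixed horizontal coordinates, \<open>heis_height p\<close> is a translation of the
  vertical coordinate. The shear thus disappears when integrating over vertical fibres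
  first.\<close>

lemma emeasure_hbox:
  assumes I: "I \<in> sets borel" and J: "J \<in> sets borel" and K: "K \<in> sets borel"
  shows "emeasure lborel (hbox p I J K) = emeasure lborel I * (emeasure lborel J * emeasure lborel K)"
proof -
  have shift: "{z. z - c \<in> A} \<in> sets borel" if "A \<in> sets borel" for c and A :: "real set"
  proof -
    have "(\<lambda>z. z - c) -` A \<inter> space borel \<in> sets borel"
      by (rule measurable_sets[of _ borel borel]) (use that in auto)
    then show ?thesis by (simp add: vimage_def)
  qed
  have "emeasure lborel (hbox p I J K) =
    emeasure lborel {x. x - fst p \<in> I} * (emeasure lborel {y. y - fst (snd p) \<in> J} * emeasure lborel K)"
  proof (rule emeasure_lborel_fibers)
    fix x assume x: "x \<in> {x. x - fst p \<in> I}"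
    show "emeasure lborel (Pair x -` hbox p I J K) = emeasure lborel {y. y - fst (snd p) \<in> J} * emeasure lborel K"
    proof (rule emeasure_lborel_fibers)
      have "Pair x \<in> borel_measurable borel" by (intro borel_measurable_continuous_onI continuous_intros)
      then have "Pair x -` hbox p I J K \<inter> space borel \<in> sets borel"
        by (rule measurable_sets) (intro borel_hbox assms)
      then show "Pair x -` hbox p I J K \<in> sets borel" by simp
      fix y assume "y \<in> {y. y - fst (snd p) \<in> J}"
      then have "Pair y -` Pair x -` hbox p I J K = {z. z - (snd (snd p) + (fst p * y - fst (snd p) * x) / 2) \<in> K}"
        using x by (auto simp: hbox_def heis_height_def algebra_simps)
      then show "emeasure lborel (Pair y -` Pair x -` hbox p I J K) = emeasure lborel K"
        using emeasure_lborel_shift[OF K] by simp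
    qed (auto simp: hbox_def shift[OF J])
  qed (use borel_hbox[OF I J K] shift[OF I] in \<open>auto simp: hbox_def\<close>)
  then show ?thesis using I J by (simp add: emeasure_lborel_shift)
qed

definition hball :: "heis \<Rightarrow> real \<Rightarrow> heis set" where
  "hball p t = {q. hdist 0 p q < t}"

lemma hball_eq_hbox: "0 < t \<Longrightarrow> hball p t = hbox p {- t<..<t} {- t<..<t} {- t\<^sup>2<..<t\<^sup>2}"
  by (auto simp: hball_def hbox_def hdist_less_iff abs_less_iff)

lemma borel_hball: "0 < t \<Longrightarrow> hball p t \<in> sets borel"
  by (simp add: hball_eq_hbox borel_hbox)

lemma emeasure_hball: "0 < t \<Longrightarrow> emeasure lborel (hball p t) = ennreal (8 * t ^ 4)"
  by (simp add: hball_eq_hbox emeasure_hbox power2_eq_square eval_nat_numeral flip: ennreal_mult)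

lemma open_hball:
  assumes t: "0 < t"
  shows "open (hball p t)"
proof -
  have "hball p t = (\<lambda>q. fst q - fst p) -` {- t<..<t} \<inter> (\<lambda>q. fst (snd q) - fst (snd p)) -` {- t<..<t} \<inter>
      heis_height p -` {- t\<^sup>2<..<t\<^sup>2}"
    by (auto simp: hball_eq_hbox t hbox_def)
  moreover have "open (heis_height p -` {- t\<^sup>2<..<t\<^sup>2})"
    unfolding heis_height_def by (auto intro!: open_vimage continuous_intros)
  moreover have "open ((\<lambda>q::heis. fst q - fst p) -` {- t<..<t})"
    by (auto intro!: open_vimage continuous_intros)
  moreover have "open ((\<lambda>q::heis. fst (snd q) - fst (snd p)) -` {- t<..<t})"
    by (auto intro!: open_vimage continuous_intros)
  ultimately show ?thesis by (simp add: open_Int)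
qed

text \<open>Each column over a square of side \<open>t\<close> is cut into boxes of height
  \<open>t\<^sup>2\<close>, in coordinates translated to its own axis; the half-open sides turn this
  into a partition.\<close>

definition tile :: "real \<Rightarrow> int \<times> int \<times> int \<Rightarrow> heis set" where
  "tile t = (\<lambda>(i, j, l). hbox (t * (of_int i + 1 / 2), t * (of_int j + 1 / 2), t\<^sup>2 * of_int l)
     {- t / 2..<t / 2} {- t / 2..<t / 2} {0..<t\<^sup>2})"

lemma borel_tile: "tile t w \<in> sets borel"
  by (cases w) (simp add: tile_def borel_hbox)

lemma emeasure_tile: "0 < t \<Longrightarrow> emeasure lborel (tile t w) = ennreal (t ^ 4)"
  by (cases w) (simp add: tile_def emeasure_hbox power2_eq_square eval_nat_numeral flip: ennreal_mult)

lemma tile_cover: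
  assumes t: "0 < t"
  shows "\<exists>w. y \<in> tile t w"
proof -
  obtain y1 y2 y3 where y: "y = (y1, y2, y3)" by (cases y)
  define i j where ij: "i = \<lfloor>y1 / t\<rfloor>" "j = \<lfloor>y2 / t\<rfloor>"
  define h where "h = y3 - (t * (of_int i + 1 / 2) * y2 - t * (of_int j + 1 / 2) * y1) / 2"
  define k where "k = \<lfloor>h / t\<^sup>2\<rfloor>"
  have "of_int i \<le> y1 / t" "y1 / t < of_int i + 1" "of_int j \<le> y2 / t" "y2 / t < of_int j + 1"
    "of_int k \<le> h / t\<^sup>2" "h / t\<^sup>2 < of_int k + 1"
    unfolding ij k_def by linarith+
  then have "t * of_int i \<le> y1" "y1 < t * of_int i + t" "t * of_int j \<le> y2" "y2 < t * of_int j + t"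
    "t\<^sup>2 * of_int k \<le> h" "h < t\<^sup>2 * of_int k + t\<^sup>2"
    using t by (simp_all add: field_simps)
  moreover have "heis_height (t * (of_int i + 1 / 2), t * (of_int j + 1 / 2), t\<^sup>2 * of_int k) y = h - t\<^sup>2 * of_int k"
    by (simp add: heis_height_def y h_def field_simps)
  ultimately have "y \<in> tile t (i, j, k)"
    using t by (auto simp: tile_def hbox_def y field_simps)
  then show ?thesis by blast
qed

lemma tile_disjoint:
  assumes t: "0 < t" and y: "y \<in> tile t w" "y \<in> tile t w'"
  shows "w = w'"
proof -
  obtain i j k i' j' k' where w: "w = (i, j, k)" "w' = (i', j', k')" by (cases w; cases w')
  have eq: "m = m'" if "\<bar>c * of_int m - c * of_int m'\<bar> < c" "0 < c" for m m' :: int and c :: real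
  proof -
    have "c * of_int m - c * of_int m' = c * of_int (m - m')" by (simp add: algebra_simps)
    then have "c * \<bar>of_int (m - m')\<bar> < c * 1" using that by (simp add: abs_mult)
    then have "\<bar>of_int (m - m') :: real\<bar> < 1" using that(2) by simp
    then show ?thesis by linarith
  qed
  have "i = i'" by (rule eq[of t]) (use t y in \<open>auto simp: w tile_def hbox_def algebra_simps abs_less_iff\<close>)
  moreover have "j = j'" by (rule eq[of t]) (use t y in \<open>auto simp: w tile_def hbox_def algebra_simps abs_less_iff\<close>)
  moreover have "k = k'"
  proof (rule eq[of "t\<^sup>2"])
    define h where "h = heis_height (t * (of_int i + 1 / 2), t * (of_int j + 1 / 2), 0) y"
    have "heis_height (t * (of_int i + 1 / 2), t * (of_int j + 1 / 2), t\<^sup>2 * of_int m) y = h - t\<^sup>2 * of_int m" for m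
      by (simp add: h_def heis_height_def)
    then have "0 \<le> h - t\<^sup>2 * of_int k" "h - t\<^sup>2 * of_int k < t\<^sup>2" "0 \<le> h - t\<^sup>2 * of_int k'" "h - t\<^sup>2 * of_int k' < t\<^sup>2"
      using y calculation by (simp_all add: w tile_def hbox_def)
    then show "\<bar>t\<^sup>2 * of_int k - t\<^sup>2 * of_int k'\<bar> < t\<^sup>2" by linarith
  qed (use t in simp)
  ultimately show ?thesis by (simp add: w)
qed

text \<open>Compared through the base point \<open>c\<close>, the heights differ by at most
  \<open>t\<^sup>2\<close> and the cocycle adds at most \<open>t\<^sup>2 / 4\<close>.\<close>

lemma hdist_tile_le:
  assumes t: "0 < t" and y: "p \<in> tile t w" "q \<in> tile t w"
  shows "hdist 0 p q \<le> 2 * t"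
proof -
  obtain i j k where w: "w = (i, j, k)" by (cases w)
  define c where "c = (t * (of_int i + 1 / 2), t * (of_int j + 1 / 2), t\<^sup>2 * of_int k)"
  have p: "\<bar>fst p - fst c\<bar> \<le> t / 2" "\<bar>fst (snd p) - fst (snd c)\<bar> \<le> t / 2" "0 \<le> heis_height c p" "heis_height c p < t\<^sup>2"
    and q: "\<bar>fst q - fst c\<bar> \<le> t / 2" "\<bar>fst (snd q) - fst (snd c)\<bar> \<le> t / 2" "0 \<le> heis_height c q" "heis_height c q < t\<^sup>2"
  proof -
    have "fst p - fst c \<in> {- t / 2..<t / 2}" "fst (snd p) - fst (snd c) \<in> {- t / 2..<t / 2}"
      "heis_height c p \<in> {0..<t\<^sup>2}" "fst q - fst c \<in> {- t / 2..<t / 2}"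
      "fst (snd q) - fst (snd c) \<in> {- t / 2..<t / 2}" "heis_height c q \<in> {0..<t\<^sup>2}"
      using y by (simp_all add: w c_def tile_def hbox_def)
    then show "\<bar>fst p - fst c\<bar> \<le> t / 2" "\<bar>fst (snd p) - fst (snd c)\<bar> \<le> t / 2" "0 \<le> heis_height c p" "heis_height c p < t\<^sup>2"
      "\<bar>fst q - fst c\<bar> \<le> t / 2" "\<bar>fst (snd q) - fst (snd c)\<bar> \<le> t / 2" "0 \<le> heis_height c q" "heis_height c q < t\<^sup>2"
      unfolding atLeastLessThan_iff by linarith+
  qed
  have d: "\<bar>fst q - fst p\<bar> \<le> t" "\<bar>fst (snd q) - fst (snd p)\<bar> \<le> t" using p q by linarith+
  have "\<bar>(fst c - fst p) * (fst (snd q) - fst (snd c))\<bar> \<le> (t / 2) * (t / 2)"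
    "\<bar>(fst (snd c) - fst (snd p)) * (fst q - fst c)\<bar> \<le> (t / 2) * (t / 2)"
    unfolding abs_mult abs_minus_commute[of "fst c"] abs_minus_commute[of "fst (snd c)" "fst (snd p)"]
    by (intro mult_mono p q; use t in simp)+
  then have "\<bar>heis_height p q\<bar> \<le> t\<^sup>2 + (t / 2) * (t / 2)"
    using p q heis_height_add[of p q c] heis_height_swap[of c p]
    by (simp only: abs_le_iff diff_divide_distrib) linarith
  also have "\<dots> \<le> (2 * t)\<^sup>2" using t by (simp add: power2_eq_square)
  finally show ?thesis using d t by (simp add: hdist_le_iff)
qed

text \<open>The site and the base point \<open>c\<close> lie on one vertical line, so heights from
  the two differ by a constant, \<open>t\<^sup>2 / 4\<close> or \<open>3 * t\<^sup>2 / 4\<close>,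
  which leaves a margin of \<open>t\<^sup>2 / 4\<close> on either side.\<close>

lemma hball_site_subset_tile:
  assumes t: "0 < t" and \<eta>: "0 < \<eta>" "\<eta> \<le> 1 / 2" and k: "k = 2 * l \<or> k = 2 * l + 1"
  shows "hball (site t i j k) (\<eta> * t) \<subseteq> tile t (i, j, l)"
proof
  fix q assume "q \<in> hball (site t i j k) (\<eta> * t)"
  then have q: "\<bar>fst q - fst (site t i j k)\<bar> < \<eta> * t" "\<bar>fst (snd q) - fst (snd (site t i j k))\<bar> < \<eta> * t"
    "\<bar>heis_height (site t i j k) q\<bar> < (\<eta> * t)\<^sup>2"
    using t \<eta> by (auto simp: hball_def hdist_less_iff)
  have 1: "\<eta> * t \<le> t / 2" using t \<eta> by (simp add: field_simps)
  have "(\<eta> * t)\<^sup>2 \<le> (t / 2)\<^sup>2" using 1 \<eta> t by (intro power_mono) auto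
  then have 2: "(\<eta> * t)\<^sup>2 \<le> t\<^sup>2 / 4" by (simp add: power2_eq_square)
  define c where "c = (t * (of_int i + 1 / 2), t * (of_int j + 1 / 2), t\<^sup>2 * of_int l)"
  have "heis_height c q = heis_height (site t i j k) q + t\<^sup>2 * (2 * of_int (k - 2 * l) + 1) / 4"
    by (simp add: c_def site_def heis_height_def field_simps)
  then have "heis_height c q = heis_height (site t i j k) q + t\<^sup>2 / 4 \<or>
      heis_height c q = heis_height (site t i j k) q + 3 * t\<^sup>2 / 4"
    using k by auto
  then have "0 \<le> heis_height c q" "heis_height c q < t\<^sup>2" using q 2 by (auto simp: abs_less_iff)
  then show "q \<in> tile t (i, j, l)"
    using q 1 by (auto simp: tile_def hbox_def c_def site_def abs_less_iff)
qed

lemma emeasure_tiles: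
  assumes t: "0 < t" and F: "finite F"
  shows "emeasure lborel (\<Union>w\<in>F. tile t w) = ennreal (real (card F) * t ^ 4)"
proof -
  have "emeasure lborel (\<Union>w\<in>F. tile t w) = (\<Sum>w\<in>F. emeasure lborel (tile t w))"
    by (rule sum_emeasure[symmetric])
       (use F borel_tile tile_disjoint[OF t] in \<open>auto simp: disjoint_family_on_def\<close>)
  also have "\<dots> = ennreal (real (card F) * t ^ 4)"
    using t by (simp add: emeasure_tile ennreal_of_nat_eq_real_of_nat flip: ennreal_mult)
  finally show ?thesis .
qed

lemma finite_tiles:
  assumes t: "0 < t" and W: "W \<in> sets borel" "emeasure lborel W < \<infinity>" and T: "\<And>w. w \<in> T \<Longrightarrow> tile t w \<subseteq> W"
  shows "finite T" "ennreal (real (card T) * t ^ 4) \<le> emeasure lborel W"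
proof -
  have le: "ennreal (real (card F) * t ^ 4) \<le> emeasure lborel W" if "F \<subseteq> T" "finite F" for F
    unfolding emeasure_tiles[OF t that(2), symmetric]
    by (rule emeasure_mono) (use W T that in auto)
  obtain m where m: "emeasure lborel W = ennreal m" "0 \<le> m" using W(2) by (cases "emeasure lborel W") auto
  have "finite T \<and> card T \<le> nat \<lceil>m / t ^ 4\<rceil>"
  proof (rule finite_if_finite_subsets_card_bdd)
    fix F assume "F \<subseteq> T" "finite F"
    then have "real (card F) * t ^ 4 \<le> m" using le[of F] m by (simp add: ennreal_le_iff)
    then have "real (card F) \<le> m / t ^ 4" using t by (simp add: field_simps)
    then show "card F \<le> nat \<lceil>m / t ^ 4\<rceil>" by linarith
  qed
  then show "finite T" by simp
  then show "ennreal (real (card T) * t ^ 4) \<le> emeasure lborel W" using le by simp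
qed

section \<open>Hausdorff measure versus Lebesgue measure\<close>

text \<open>Cover \<open>E\<close> by the tiles of size \<open>t\<close> that meet it. They are
  disjoint subsets of \<open>W\<close> of volume \<open>t ^ 4\<close> and diameter at most
  \<open>2 * c * t\<close>.\<close>

lemma hausdorff_premeasure_le_lborel:
  assumes t: "0 < t" and c: "0 < c" and D: "\<And>p q. D p q \<le> c * hdist 0 p q"
    and W: "W \<in> sets borel" "emeasure lborel W < \<infinity>"
    and E: "\<And>p q. p \<in> E \<Longrightarrow> hdist 0 p q \<le> 2 * t \<Longrightarrow> q \<in> W" and \<delta>: "2 * c * t \<le> \<delta>"
  shows "hausdorff_premeasure UNIV D 4 \<delta> E \<le> ennreal ((2 * c) ^ 4) * emeasure lborel W"
proof -
  define T where "T = {w. tile t w \<inter> E \<noteq> {}}"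
  have TW: "tile t w \<subseteq> W" if "w \<in> T" for w using that E hdist_tile_le[OF t] unfolding T_def by blast
  note fin = finite_tiles[OF t W TW]
  define n where "n = card T"
  obtain e where e: "bij_betw e {0..<n} T" using fin(1) ex_bij_betw_nat_finite unfolding n_def by blast
  \<comment> \<open>Coverings are sequences, so the finite family is padded with empty sets, which
    contribute \<open>0 powr 4 = 0\<close>.\<close>
  define U where "U i = (if i < n then tile t (e i) else {})" for i
  have dia: "ediam D (U i) \<le> ennreal (2 * c * t)" for i
  proof -
    have "D p q \<le> 2 * c * t" if "p \<in> U i" "q \<in> U i" for p q
    proof -
      have "hdist 0 p q \<le> 2 * t" using that hdist_tile_le[OF t] by (auto simp: U_def split: if_splits)
      then have "c * hdist 0 p q \<le> c * (2 * t)" using c by simp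
      then show ?thesis using D[of p q] by simp
    qed
    then show ?thesis unfolding ediam_def by (intro SUP_least ennreal_leI)
  qed
  have cover: "E \<subseteq> (\<Union>i. U i)"
  proof
    fix p assume p: "p \<in> E"
    obtain w where w: "p \<in> tile t w" using tile_cover[OF t] by blast
    then have "w \<in> T" using p by (auto simp: T_def)
    then obtain i where "i < n" "e i = w" using e by (auto simp: bij_betw_def)
    then show "p \<in> (\<Union>i. U i)" using w by (auto simp: U_def intro!: exI[of _ i])
  qed
  have "hausdorff_premeasure UNIV D 4 \<delta> E \<le> (\<Sum>i. ennreal (enn2real (ediam D (U i)) powr 4))"
    unfolding hausdorff_premeasure_def
    by (rule INF_lower) (use cover order_trans[OF dia ennreal_leI[OF \<delta>]] in auto)
  also have "\<dots> = (\<Sum>i<n. ennreal (enn2real (ediam D (U i)) powr 4))"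
    by (rule suminf_finite) (auto simp: U_def ediam_def bot_ennreal)
  also have "\<dots> \<le> (\<Sum>i<n. ennreal ((2 * c * t) ^ 4))"
  proof (intro sum_mono ennreal_leI)
    fix i
    have "enn2real (ediam D (U i)) \<le> 2 * c * t" using dia c t by (intro enn2real_leI) auto
    then have "enn2real (ediam D (U i)) ^ 4 \<le> (2 * c * t) ^ 4" by (intro power_mono) auto
    then show "enn2real (ediam D (U i)) powr 4 \<le> (2 * c * t) ^ 4"
      by (simp add: powr_numeral)
  qed
  also have "\<dots> = ennreal ((2 * c) ^ 4) * ennreal (real n * t ^ 4)"
    using c t by (simp add: ennreal_of_nat_eq_real_of_nat power_mult_distrib mult_ac flip: ennreal_mult)
  also have "\<dots> \<le> ennreal ((2 * c) ^ 4) * emeasure lborel W"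
    unfolding n_def using fin(2) by (intro mult_left_mono) auto
  finally show ?thesis .
qed

lemma hausdorff_premeasure_null_UN:
  fixes B :: "nat \<Rightarrow> 'a set"
  assumes B: "\<And>k. hausdorff_premeasure M D s \<delta> (B k) = 0" and A: "A \<subseteq> (\<Union>k. B k)"
  shows "hausdorff_premeasure M D s \<delta> A = 0"
proof -
  define V where "V U = (\<Sum>i. ennreal (enn2real (ediam D (U i)) powr s))" for U :: "nat \<Rightarrow> 'a set"
  define adm where "adm A U \<longleftrightarrow> A \<subseteq> (\<Union>i. U i) \<and> (\<forall>i. U i \<subseteq> M \<and> ediam D (U i) \<le> ennreal \<delta>)"
    for A and U :: "nat \<Rightarrow> 'a set"
  have pre: "hausdorff_premeasure M D s \<delta> A = (INF U\<in>Collect (adm A). V U)" for A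
    by (simp add: hausdorff_premeasure_def V_def adm_def[abs_def])
  have "hausdorff_premeasure M D s \<delta> A \<le> ennreal e" if e: "e > 0" for e
  proof -
    have "\<exists>U. adm (B k) U \<and> V U < ennreal (e * (1 / 2) ^ Suc k)" for k
    proof -
      have "(INF U\<in>Collect (adm (B k)). V U) < ennreal (e * (1 / 2) ^ Suc k)"
        using B[of k] e unfolding pre by simp
      then show ?thesis unfolding INF_less_iff by blast
    qed
    then obtain U where U: "\<And>k. adm (B k) (U k)" "\<And>k. V (U k) < ennreal (e * (1 / 2) ^ Suc k)" by metis
    define W where "W n = (case prod_decode n of (k, i) \<Rightarrow> U k i)" for n
    have "adm A W"
    proof -
      have "p \<in> (\<Union>i. W i)" if "p \<in> A" for p
      proof -
        obtain k i where "p \<in> U k i" using A U(1) \<open>p \<in> A\<close> unfolding adm_def by blast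
        then have "p \<in> W (prod_encode (k, i))" by (simp add: W_def)
        then show ?thesis by blast
      qed
      moreover have "W i \<subseteq> M \<and> ediam D (W i) \<le> ennreal \<delta>" for i
        using U(1) by (auto simp: W_def adm_def split: prod.splits)
      ultimately show ?thesis unfolding adm_def by blast
    qed
    then have "hausdorff_premeasure M D s \<delta> A \<le> V W" unfolding pre by (intro INF_lower) auto
    also have "V W = (\<Sum>n. (\<lambda>(k, i). ennreal (enn2real (ediam D (U k i)) powr s)) (prod_decode n))"
      unfolding V_def W_def by (intro arg_cong[where f=suminf]) (simp add: fun_eq_iff split: prod.split)
    also have "\<dots> = (\<Sum>k. V (U k))"
      by (rule suminf_ennreal_2dimen) (simp add: V_def)
    also have "\<dots> \<le> (\<Sum>k. ennreal (e * (1 / 2) ^ Suc k))"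
      using U(2) by (intro suminf_le) (auto intro: less_imp_le)
    also have "\<dots> = ennreal (\<Sum>k. e * (1 / 2) ^ Suc k)"
      using e by (intro suminf_ennreal2 summable_mult) (auto simp: summable_Suc_iff)
    also have "\<dots> = ennreal e"
      using sums_mult[OF power_half_series, of e] by (simp add: sums_iff)
    finally show ?thesis .
  qed
  then have "hausdorff_premeasure M D s \<delta> A \<le> 0 + ennreal e" if "e > 0" for e
    using that by simp
  then have "hausdorff_premeasure M D s \<delta> A \<le> 0" by (rule ennreal_le_epsilon)
  then show ?thesis by simp
qed

section \<open>Ahlfors regularity\<close>

text \<open>Three balls of radius \<open>1282 * r\<close> have total volume
  \<open>3 * 8 * (1282 * r) ^ 4\<close>. The margin of \<open>2 * r\<close> beyond 1280 makes room
  for the tiles of size up to \<open>r\<close> that meet the ball.\<close>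

lemma sdist_ball_neighbourhood:
  assumes r: "0 < r"
  obtains W where "W \<in> sets borel" "emeasure lborel W \<le> ennreal (24 * 1282 ^ 4 * r ^ 4)"
    "\<And>y q. sdist x y < r \<Longrightarrow> hdist 0 y q \<le> 2 * r \<Longrightarrow> q \<in> W"
proof -
  obtain E where E: "finite E" "card E \<le> 3" "\<And>y. sdist x y < r \<Longrightarrow> \<exists>e\<in>E. hdist 0 e y < 1280 * r"
    using sdist_ball[OF r] by blast
  define W where "W = (\<Union>e\<in>E. hball e (1282 * r))"
  have "emeasure lborel W \<le> (\<Sum>e\<in>E. emeasure lborel (hball e (1282 * r)))"
    unfolding W_def by (rule emeasure_subadditive_finite) (use E r borel_hball in auto)
  also have "\<dots> = ennreal (real (card E) * (8 * (1282 * r) ^ 4))"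
    using r by (simp add: emeasure_hball ennreal_of_nat_eq_real_of_nat flip: ennreal_mult)
  also have "\<dots> \<le> ennreal (3 * (8 * (1282 * r) ^ 4))"
    using E(2) r by (intro ennreal_leI mult_right_mono) auto
  also have "3 * (8 * (1282 * r) ^ 4) = 24 * 1282 ^ 4 * r ^ 4" by (simp add: power_mult_distrib)
  finally have 1: "emeasure lborel W \<le> ennreal (24 * 1282 ^ 4 * r ^ 4)" .
  have 2: "W \<in> sets borel" unfolding W_def using E(1) r borel_hball by (intro sets.finite_UN) auto
  have "q \<in> W" if y: "sdist x y < r" "hdist 0 y q \<le> 2 * r" for y q
  proof -
    obtain e where e: "e \<in> E" "hdist 0 e y < 1280 * r" using E(3)[OF y(1)] by blast
    have "hdist 0 e q < 1282 * r" using hdist_triangle[of 0 e q y] e y by simp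
    then show ?thesis using e by (auto simp: W_def hball_def)
  qed
  then show ?thesis using that[OF 2 1] by blast
qed

lemma le_enn2real_ediam:
  assumes "x \<in> S" "y \<in> S" "ediam d S \<le> ennreal \<delta>"
  shows "d x y \<le> enn2real (ediam d S)"
proof -
  have "ennreal (d x y) \<le> ediam d S"
    unfolding ediam_def using assms(1,2) by (intro SUP_upper2[of x] SUP_upper2[of y]) auto
  also have "ediam d S = ennreal (enn2real (ediam d S))"
    using le_less_trans[OF assms(3) ennreal_less_top] by (simp add: ennreal_enn2real_if)
  finally show ?thesis by (simp add: ennreal_le_iff)
qed

lemma hausdorff_measure_sdist_ball_le:
  assumes r: "0 < r"
  shows "hausdorff_measure UNIV sdist 4 {y. sdist x y < r} \<le> ennreal (16 * (24 * 1282 ^ 4) * r ^ 4)"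
  unfolding hausdorff_measure_def
proof (rule SUP_least)
  fix \<delta> :: real assume "\<delta> \<in> {0<..}"
  then have \<delta>: "0 < \<delta>" by simp
  obtain W where W: "W \<in> sets borel" "emeasure lborel W \<le> ennreal (24 * 1282 ^ 4 * r ^ 4)"
    "\<And>y q. sdist x y < r \<Longrightarrow> hdist 0 y q \<le> 2 * r \<Longrightarrow> q \<in> W"
    by (rule sdist_ball_neighbourhood[OF r, of x]) blast
  \<comment> \<open>The first bound keeps the tiles inside \<open>W\<close>, the second keeps their
    diameters below \<open>\<delta>\<close>; the resulting estimate does not depend on
    \<open>\<delta>\<close>.\<close>
  define t where "t = min r (\<delta> / 2)"
  have "hausdorff_premeasure UNIV sdist 4 \<delta> {y. sdist x y < r} \<le> ennreal ((2 * 1) ^ 4) * emeasure lborel W"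
  proof (rule hausdorff_premeasure_le_lborel[where t=t])
    show "emeasure lborel W < \<infinity>" using W(2) by (simp add: le_less_trans)
    fix p q assume "p \<in> {y. sdist x y < r}" "hdist 0 p q \<le> 2 * t"
    then show "q \<in> W" by (intro W(3)[of p]) (auto simp: t_def)
  qed (use r \<delta> W sdist_le_hdist in \<open>auto simp: t_def\<close>)
  also have "\<dots> \<le> ennreal ((2 * 1) ^ 4) * ennreal (24 * 1282 ^ 4 * r ^ 4)"
    using W(2) by (intro mult_left_mono) auto
  also have "\<dots> = ennreal (16 * (24 * 1282 ^ 4) * r ^ 4)"
    using r by (subst ennreal_mult[symmetric]) simp_all
  finally show "hausdorff_premeasure UNIV sdist 4 \<delta> {y. sdist x y < r} \<le> ennreal (16 * (24 * 1282 ^ 4) * r ^ 4)" .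
qed

text \<open>The mass distribution principle, with Lebesgue measure as the mass.\<close>

lemma hausdorff_measure_sdist_ball_ge:
  assumes r: "0 < r"
  shows "ennreal (1 / (16 * (24 * 1282 ^ 4)) * r ^ 4) \<le> hausdorff_measure UNIV sdist 4 {y. sdist x y < r}"
proof -
  define K :: real where "K = 24 * 1282 ^ 4"
  have K: "0 < K" by (simp add: K_def)
  have "ennreal (1 / (16 * K) * r ^ 4) \<le> hausdorff_premeasure UNIV sdist 4 1 {y. sdist x y < r}"
    unfolding hausdorff_premeasure_def
  proof (rule INF_greatest, clarify)
    fix U :: "nat \<Rightarrow> heis set" assume cover: "{y. sdist x y < r} \<subseteq> (\<Union>i. U i)" and U: "\<forall>i. U i \<subseteq> UNIV \<and> ediam sdist (U i) \<le> ennreal 1"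
    define a where "a i = enn2real (ediam sdist (U i))" for i
    have "\<exists>V\<in>sets borel. U i \<subseteq> V \<and> emeasure lborel V \<le> ennreal (16 * K) * ennreal (a i powr 4)" for i
    proof (cases "U i = {}")
      case True
      then show ?thesis by (intro bexI[of _ "{}"]) auto
    next
      case False
      then obtain u where u: "u \<in> U i" by auto
      have le: "sdist u y \<le> a i" if "y \<in> U i" for y
        unfolding a_def by (rule le_enn2real_ediam[OF u that]) (use U in blast)
      have a0: "0 \<le> a i" by (simp add: a_def)
      \<comment> \<open>A set of diameter 0 adds nothing to the sum, so it must be given a null
        \<open>V\<close>; it is a single point. Otherwise the open ball of radius
        \<open>2 * a i\<close> contains \<open>U i\<close>, and 16 is \<open>2 ^ 4\<close>.\<close>
      show ?thesis
      proof (cases "a i = 0")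
        case True
        have "U i \<subseteq> {u}"
        proof
          fix y assume "y \<in> U i"
          then have "sdist u y = 0" using le[of y] sdist_nonneg[of u y] True by simp
          then show "y \<in> {u}" by (simp add: sdist_eq_0_iff)
        qed
        then show ?thesis by (intro bexI[of _ "{u}"]) auto
      next
        case False
        then have a: "0 < 2 * a i" using a0 by simp
        obtain W where W: "W \<in> sets borel" "emeasure lborel W \<le> ennreal (24 * 1282 ^ 4 * (2 * a i) ^ 4)"
          "\<And>y q. sdist u y < 2 * a i \<Longrightarrow> hdist 0 y q \<le> 2 * (2 * a i) \<Longrightarrow> q \<in> W"
          by (rule sdist_ball_neighbourhood[OF a, of u]) blast
        have "U i \<subseteq> W"
        proof
          fix y assume "y \<in> U i"
          then have "sdist u y < 2 * a i" using le[of y] a by simp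
          then show "y \<in> W" by (rule W(3)) (use a in simp)
        qed
        moreover have eq: "24 * 1282 ^ 4 * (2 * a i) ^ 4 = 16 * K * (a i powr 4)"
          using a0 by (simp add: K_def power_mult_distrib powr_numeral)
        have "ennreal (24 * 1282 ^ 4 * (2 * a i) ^ 4) = ennreal (16 * K) * ennreal (a i powr 4)"
          unfolding eq by (rule ennreal_mult) (use K in simp_all)
        ultimately show ?thesis using W(1,2) by metis
      qed
    qed
    then obtain V where V: "\<And>i. V i \<in> sets borel" "\<And>i. U i \<subseteq> V i"
      "\<And>i. emeasure lborel (V i) \<le> ennreal (16 * K) * ennreal (a i powr 4)" by metis
    \<comment> \<open>The mass from below: shortcuts only enlarge balls, so the ball of
      \<open>sdist\<close> contains a box of known volume.\<close>
    have "hball x r \<subseteq> (\<Union>i. V i)"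
    proof
      fix y assume "y \<in> hball x r"
      then have "sdist x y < r" using sdist_le_hdist[of x y] by (simp add: hball_def)
      then show "y \<in> (\<Union>i. V i)" using cover V(2) by blast
    qed
    moreover have "(\<Union>i. V i) \<in> sets borel" by (rule sets.countable_nat_UN) (use V(1) in blast)
    ultimately have "emeasure lborel (hball x r) \<le> emeasure lborel (\<Union>i. V i)"
      by (intro emeasure_mono) simp_all
    also have "\<dots> \<le> (\<Sum>i. emeasure lborel (V i))"
      using V(1) by (intro emeasure_subadditive_countably) auto
    also have "\<dots> \<le> (\<Sum>i. ennreal (16 * K) * ennreal (a i powr 4))"
      using V(3) by (intro suminf_le) auto
    also have "\<dots> = ennreal (16 * K) * (\<Sum>i. ennreal (a i powr 4))" by simp
    finally have *: "ennreal (8 * r ^ 4) \<le> ennreal (16 * K) * (\<Sum>i. ennreal (a i powr 4))"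
      using r by (simp add: emeasure_hball)
    have "ennreal (1 / (16 * K) * r ^ 4) \<le> ennreal (1 / (16 * K) * (8 * r ^ 4))"
      using K by (intro ennreal_leI mult_left_mono) auto
    also have "\<dots> = ennreal (1 / (16 * K)) * ennreal (8 * r ^ 4)" using K by (intro ennreal_mult) simp_all
    also have "\<dots> \<le> ennreal (1 / (16 * K)) * (ennreal (16 * K) * (\<Sum>i. ennreal (a i powr 4)))"
      using * by (intro mult_left_mono) auto
    also have "\<dots> = (\<Sum>i. ennreal (a i powr 4))"
    proof -
      have "ennreal (1 / (16 * K)) * ennreal (16 * K) = ennreal (1 / (16 * K) * (16 * K))"
        using K by (intro ennreal_mult[symmetric]) simp_all
      also have "\<dots> = 1" using K by simp
      finally show ?thesis by (simp only: mult.assoc[symmetric] mult_1)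
    qed
    finally show "ennreal (1 / (16 * K) * r ^ 4) \<le> (\<Sum>i. ennreal (enn2real (ediam sdist (U i)) powr 4))"
      by (simp add: a_def)
  qed
  also have "\<dots> \<le> hausdorff_measure UNIV sdist 4 {y. sdist x y < r}"
    unfolding hausdorff_measure_def by (rule SUP_upper) auto
  finally show ?thesis by (simp only: K_def)
qed

lemma ahlfors_regular_sdist: "ahlfors_regular UNIV sdist 4"
proof -
  have mball: "Metric_space.mball UNIV sdist x r = {y. sdist x y < r}" for x r
    by (simp add: Metric_space.mball_def[OF Metric_space_sdist])
  show ?thesis
    unfolding ahlfors_regular_def mball
  proof (intro exI[of _ "16 * (24 * 1282 ^ 4) :: real"] conjI ballI allI impI)
    fix x and r :: real assume r: "0 < r"
    then have "r powr 4 = r ^ 4" by (simp add: powr_numeral)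
    then show "ennreal (1 / (16 * (24 * 1282 ^ 4)) * r powr 4) \<le> hausdorff_measure UNIV sdist 4 {y. sdist x y < r}"
      "hausdorff_measure UNIV sdist 4 {y. sdist x y < r} \<le> ennreal (16 * (24 * 1282 ^ 4) * r powr 4)"
      using hausdorff_measure_sdist_ball_ge[OF r] hausdorff_measure_sdist_ball_le[OF r] by simp_all
  qed simp
qed

section \<open>Absence of biLipschitz pieces\<close>

text \<open>A vertical displacement is the height plus half a product of the base point with the
  horizontal displacement. For points of norm at most \<open>R\<close> and \<open>r \<le> 1\<close>,
  the Euclidean displacement is therefore at most \<open>(3 + R) * r\<close>.\<close>

lemma compact_hdist_neighbourhood:
  assumes B: "compact B" and U: "open U" "B \<subseteq> U"
  obtains r where "0 < r" "\<And>p q. p \<in> B \<Longrightarrow> hdist 0 p q \<le> r \<Longrightarrow> q \<in> U"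
proof -
  obtain e where e: "0 < e" "(\<Union>x\<in>B. ball x e) \<subseteq> U"
    using compact_subset_open_imp_ball_epsilon_subset[OF B U] by blast
  obtain R where R: "0 < R" "\<And>p. p \<in> B \<Longrightarrow> norm p \<le> R"
    using compact_imp_bounded[OF B] unfolding bounded_pos by blast
  define r where "r = min 1 (e / (2 * (3 + R)))"
  have r: "0 < r" "r \<le> 1" using e R by (auto simp: r_def)
  have "(3 + R) * r \<le> (3 + R) * (e / (2 * (3 + R)))"
    using R by (intro mult_left_mono) (auto simp: r_def)
  also have "\<dots> = e / 2" using R by (simp add: field_simps)
  finally have re: "(3 + R) * r < e" using e by simp
  have "q \<in> U" if p: "p \<in> B" and pq: "hdist 0 p q \<le> r" for p q
  proof -
    have h: "\<bar>fst q - fst p\<bar> \<le> r" "\<bar>fst (snd q) - fst (snd p)\<bar> \<le> r" "\<bar>heis_height p q\<bar> \<le> r\<^sup>2"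
      using pq r by (auto simp: hdist_le_iff)
    have "r\<^sup>2 \<le> r" using r by (simp add: power2_eq_square mult_left_le)
    have n: "\<bar>fst p\<bar> \<le> R" "\<bar>fst (snd p)\<bar> \<le> R"
      using R(2)[OF p] norm_fst_le[of "fst p" "snd p"] norm_snd_le[of "snd p" "fst p"]
        norm_fst_le[of "fst (snd p)" "snd (snd p)"] by auto
    have "\<bar>fst p * (fst (snd q) - fst (snd p))\<bar> \<le> R * r" "\<bar>fst (snd p) * (fst q - fst p)\<bar> \<le> R * r"
      unfolding abs_mult using n h R r by (auto intro!: mult_mono)
    moreover have "snd (snd q) - snd (snd p) = heis_height p q + (fst p * (fst (snd q) - fst (snd p))) / 2 -
        (fst (snd p) * (fst q - fst p)) / 2"
      by (simp add: heis_height_def field_simps)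
    ultimately have z: "\<bar>snd (snd q) - snd (snd p)\<bar> \<le> r + R * r"
      using h(3) \<open>r\<^sup>2 \<le> r\<close> by (simp only: abs_le_iff) linarith
    have "norm (q - p) \<le> norm (fst (q - p)) + norm (snd (q - p))"
      using norm_Pair_le[of "fst (q - p)" "snd (q - p)"] by (simp only: prod.collapse)
    also have "norm (snd (q - p)) \<le> norm (fst (snd (q - p))) + norm (snd (snd (q - p)))"
      using norm_Pair_le[of "fst (snd (q - p))" "snd (snd (q - p))"] by (simp only: prod.collapse)
    finally have "norm (q - p) \<le> r + (r + (r + R * r))" using h z by simp
    also have "\<dots> = (3 + R) * r" by (simp add: algebra_simps)
    finally have "q \<in> ball p e" using re by (simp add: dist_norm norm_minus_commute)
    then show ?thesis using e(2) p by blast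
  qed
  then show ?thesis using that r by blast
qed

text \<open>An open set of small volume around \<open>B\<close> contains, by compactness, all
  sufficiently small tiles that meet \<open>B\<close>. The factor 80 is twice the comparison
  constant 40.\<close>

lemma hausdorff_premeasure_d_cc_null:
  assumes B: "compact B" "emeasure lborel B = 0" and \<delta>: "0 < \<delta>"
  shows "hausdorff_premeasure UNIV d_cc 4 \<delta> B = 0"
proof -
  have "hausdorff_premeasure UNIV d_cc 4 \<delta> B \<le> 0 + ennreal e" if e: "0 < e" for e
  proof -
    have bB: "B \<in> sets borel" using B(1) by (simp add: borel_compact)
    obtain U where U: "open U" "B \<subseteq> U" "emeasure lborel (U - B) < ennreal (e / 80 ^ 4)"
      using outer_regular_lborel[OF bB, of "e / 80 ^ 4"] e by auto
    have bU: "U \<in> sets borel" using U(1) by simp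
    have "emeasure lborel U \<le> emeasure lborel B + emeasure lborel (U - B)"
      using emeasure_subadditive[of B lborel "U - B"] bB bU U(2) by (simp add: Un_absorb1)
    then have le: "emeasure lborel U \<le> ennreal (e / 80 ^ 4)" using U(3) B(2) by simp
    obtain r where r: "0 < r" "\<And>p q. p \<in> B \<Longrightarrow> hdist 0 p q \<le> r \<Longrightarrow> q \<in> U"
      using compact_hdist_neighbourhood[OF B(1) U(1,2)] by blast
    have "hausdorff_premeasure UNIV d_cc 4 \<delta> B \<le> ennreal ((2 * 40) ^ 4) * emeasure lborel U"
      by (rule hausdorff_premeasure_le_lborel[where t="min (r / 2) (\<delta> / 80)"])
         (use r \<delta> d_cc_le_hdist bU le in \<open>auto intro: le_less_trans\<close>)
    also have "\<dots> \<le> ennreal ((2 * 40) ^ 4) * ennreal (e / 80 ^ 4)" using le by (intro mult_left_mono) auto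
    also have "\<dots> = ennreal e" using e by (subst ennreal_mult[symmetric]) simp_all
    finally show ?thesis by simp
  qed
  then have "hausdorff_premeasure UNIV d_cc 4 \<delta> B \<le> 0" by (rule ennreal_le_epsilon)
  then show ?thesis by simp
qed

text \<open>
  A substitute for the density theorem: by outer regularity, the fine tiles meeting a compact set
  have about the measure of the set in total.
\<close>

lemma emeasure_porous_compact:
  assumes B: "compact B" and c: "0 \<le> c" "c < 1"
    and porous: "\<And>n w. N \<le> n \<Longrightarrow>
      emeasure lborel (B \<inter> tile (level_scale n) w) \<le> ennreal (c * level_scale n ^ 4)"
  shows "emeasure lborel B = 0"
proof -
  have bB: "B \<in> sets borel" using B by (simp add: borel_compact)
  have "emeasure lborel B < \<infinity>" using emeasure_bounded_finite[OF compact_imp_bounded[OF B]] by simp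
  then obtain m where m: "emeasure lborel B = ennreal m" "0 \<le> m" by (cases "emeasure lborel B") auto
  have "m \<le> 0"
  proof (rule ccontr)
    assume "\<not> m \<le> 0"
    \<comment> \<open>The tiles fill volume at most \<open>m + e\<close>, and \<open>B\<close> at
      most the fraction \<open>c\<close> of it; this \<open>e\<close> turns the bound into
      \<open>m - (1 - c) * (1 - c) * m\<close>, which is less than \<open>m\<close>.\<close>
    define e where "e = (1 - c) * m"
    have e: "0 < e" using \<open>\<not> m \<le> 0\<close> c by (simp add: e_def)
    obtain U where U: "open U" "B \<subseteq> U" "emeasure lborel (U - B) < ennreal e"
      using outer_regular_lborel[OF bB e] by auto
    have bU: "U \<in> sets borel" using U(1) by simp
    have "emeasure lborel U \<le> emeasure lborel B + emeasure lborel (U - B)"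
      using emeasure_subadditive[of B lborel "U - B"] bB bU U(2) by (simp add: Un_absorb1)
    also have "\<dots> \<le> ennreal m + ennreal e" using U(3) m by (intro add_mono) auto
    finally have le: "emeasure lborel U \<le> ennreal (m + e)" using m(2) e by simp
    obtain r where r: "0 < r" "\<And>p q. p \<in> B \<Longrightarrow> hdist 0 p q \<le> r \<Longrightarrow> q \<in> U"
      using compact_hdist_neighbourhood[OF B U(1,2)] by blast
    have "\<forall>\<^sub>F n in sequentially. level_scale n < r / 2 \<and> N \<le> n"
      using order_tendstoD(2)[OF level_scale_tendsto_0, of "r / 2"] r(1)
      by (intro eventually_conj eventually_ge_at_top) auto
    then obtain n where n: "level_scale n < r / 2" "N \<le> n" by (auto simp: eventually_sequentially)
    define t where "t = level_scale n"
    have t: "0 < t" by (simp add: t_def)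
    define T where "T = {w. tile t w \<inter> B \<noteq> {}}"
    have TU: "tile t w \<subseteq> U" if w: "w \<in> T" for w
    proof
      fix q assume q: "q \<in> tile t w"
      obtain p where p: "p \<in> tile t w" "p \<in> B" using w by (auto simp: T_def)
      then have "hdist 0 p q \<le> r" using hdist_tile_le[OF t p(1) q] n by (simp add: t_def)
      then show "q \<in> U" using r(2) p by blast
    qed
    have fin: "finite T" "ennreal (real (card T) * t ^ 4) \<le> emeasure lborel U"
      using finite_tiles[OF t bU _ TU] le by (simp_all add: le_less_trans)
    have "B \<subseteq> (\<Union>w\<in>T. B \<inter> tile t w)" using tile_cover[OF t] by (fastforce simp: T_def)
    then have "emeasure lborel B \<le> emeasure lborel (\<Union>w\<in>T. B \<inter> tile t w)"
      using fin(1) bB borel_tile by (intro emeasure_mono) auto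
    also have "\<dots> \<le> (\<Sum>w\<in>T. emeasure lborel (B \<inter> tile t w))"
      using fin(1) bB borel_tile by (intro emeasure_subadditive_finite) auto
    also have "\<dots> \<le> (\<Sum>w\<in>T. ennreal (c * t ^ 4))"
      using porous[OF n(2)] unfolding t_def by (intro sum_mono) auto
    also have "\<dots> = ennreal c * ennreal (real (card T) * t ^ 4)"
      using c t by (simp add: ennreal_of_nat_eq_real_of_nat mult_ac flip: ennreal_mult)
    also have "\<dots> \<le> ennreal c * ennreal (m + e)"
      using fin(2) le by (intro mult_left_mono) auto
    also have "\<dots> = ennreal (c * (m + e))" using c m e by (simp add: ennreal_mult)
    finally have "m \<le> c * (m + e)" using m c e by (simp add: ennreal_le_iff)
    also have "c * (m + e) = m - (1 - c) * (1 - c) * m" by (simp add: e_def algebra_simps)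
    also have "\<dots> < m" using c \<open>\<not> m \<le> 0\<close> by simp
    finally show False by simp
  qed
  then show ?thesis using m by (simp add: ennreal_eq_0_iff)
qed

text \<open>
  The ends of a shortcut of level \<open>n\<close> cannot both be approximated in \<open>A\<close> within a small multiple of
  the scale once \<open>2\<^sup>-\<^sup>n\<close>, the ratio of cost to scale, is small.
\<close>

lemma bilipschitz_misses_hball:
  assumes L: "1 \<le> L" "\<And>p q. p \<in> A \<Longrightarrow> q \<in> A \<Longrightarrow> hdist 0 p q \<le> L * sdist p q"
    and n: "(1 / 2) ^ n \<le> 1 / (16 * L)"
  shows "\<exists>k\<in>{2 * l, 2 * l + 1}. A \<inter> hball (site (level_scale n) i j k) (1 / (16 * L) * level_scale n) = {}"
proof (rule ccontr)
  \<comment> \<open>Points of \<open>A\<close> within \<open>\<eta> * t\<close> of both ends would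
    have \<open>sdist\<close> at most \<open>3 * (\<eta> * t)\<close>, hence \<open>hdist 0\<close>
    at most \<open>3 * t / 16\<close>. Adding \<open>2 * (\<eta> * t)\<close>, at most
    \<open>t / 8\<close>, does not reach the distance \<open>t / 2\<close> of the ends.\<close>
  define t \<eta> where t\<eta>: "t = level_scale n" "\<eta> = 1 / (16 * L)"
  have t: "0 < t" and \<eta>: "0 < \<eta>" using L by (simp_all add: t\<eta>)
  define a b where ab: "a = site t i j (2 * l)" "b = site t i j (2 * l + 1)"
  assume "\<not> ?thesis"
  then obtain p q where p: "p \<in> A" "hdist 0 a p < \<eta> * t" and q: "q \<in> A" "hdist 0 b q < \<eta> * t"
    unfolding hball_def ab t\<eta> by blast
  have "t / 2 \<le> hdist 0 a b"
    unfolding ab by (rule hdist_site_ge) (use t in \<open>auto simp: power2_eq_square\<close>)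
  also have "\<dots> \<le> hdist 0 a p + (hdist 0 p q + hdist 0 q b)"
    using hdist_triangle[of 0 a b p] hdist_triangle[of 0 p b q] by simp
  also have "hdist 0 q b = hdist 0 b q" by (rule hdist_commute)
  finally have 1: "t / 2 \<le> 2 * (\<eta> * t) + hdist 0 p q" using p q by simp
  have "shortcut (level_scale n) a b" unfolding shortcut_def ab t\<eta> by blast
  from sdist_shortcut[OF this] have "sdist a b \<le> (1 / 2) ^ n * t" by (simp add: level_cost_eq t\<eta>)
  also have "\<dots> \<le> \<eta> * t" using n t unfolding t\<eta>(2) by (intro mult_right_mono) auto
  finally have "sdist a b \<le> \<eta> * t" .
  moreover have "sdist p q \<le> sdist p a + (sdist a b + sdist b q)"
    using sdist_triangle[of p q a] sdist_triangle[of a q b] by simp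
  moreover have "sdist p a \<le> hdist 0 a p" using sdist_le_hdist[of a p] by (simp add: sdist_commute)
  ultimately have "sdist p q \<le> 3 * (\<eta> * t)" using sdist_le_hdist[of b q] p q by linarith
  then have "L * sdist p q \<le> L * (3 * (\<eta> * t))" using L by (intro mult_left_mono) auto
  then have 2: "hdist 0 p q \<le> 3 * t / 16" using L(2)[OF p(1) q(1)] L(1) by (simp add: t\<eta>)
  have "\<eta> * t \<le> 1 / 16 * t" using t L unfolding t\<eta>(2) by (intro mult_right_mono) (auto simp: field_simps)
  then show False using 1 2 t by linarith
qed

lemma bilipschitz_hausdorff_measure_zero:
  assumes "bilipschitz_equivalent_on A sdist d_cc"
  shows "hausdorff_measure UNIV d_cc 4 A = 0"
proof -
  obtain L where L: "1 \<le> L" "\<And>p q. p \<in> A \<Longrightarrow> q \<in> A \<Longrightarrow> 1 / L * d_cc p q \<le> sdist p q"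
    using assms unfolding bilipschitz_equivalent_on_def by blast
  have lip: "hdist 0 p q \<le> L * sdist p q" if "p \<in> A" "q \<in> A" for p q
  proof -
    have "hdist 0 p q \<le> d_cc p q" by (rule hdist_le_d_cc)
    also have "\<dots> \<le> L * sdist p q" using L(2)[OF that] L(1) by (simp add: field_simps)
    finally show ?thesis .
  qed
  define \<eta> where "\<eta> = 1 / (16 * L)"
  have \<eta>: "0 < \<eta>" "\<eta> \<le> 1 / 2" using L(1) by (simp_all add: \<eta>_def field_simps)
  obtain N where N: "(1 / 2 :: real) ^ N < \<eta>" using real_arch_pow_inv[of \<eta> "1 / 2"] \<eta> by auto
  define B where "B k = closure A \<inter> cball 0 (real k)" for k :: nat
  have comp: "compact (B k)" for k unfolding B_def by (intro closed_Int_compact) auto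
  \<comment> \<open>The missed ball has volume \<open>8 * (\<eta> * t) ^ 4\<close> inside a tile of
    volume \<open>t ^ 4\<close>.\<close>
  define c where "c = 1 - 8 * \<eta> ^ 4"
  have "\<eta> ^ 4 \<le> (1 / 2) ^ 4" using \<eta> by (intro power_mono) auto
  then have c: "0 \<le> c" "c < 1" using \<eta> by (simp_all add: c_def power4_eq_xxxx)
  have null: "emeasure lborel (B k) = 0" for k
  proof (rule emeasure_porous_compact[OF comp c, of N])
    fix n and w :: "int \<times> int \<times> int" assume n: "N \<le> n"
    define t where "t = level_scale n"
    have t: "0 < t" by (simp add: t_def)
    obtain i j l where w: "w = (i, j, l)" by (cases w)
    have "(1 / 2 :: real) ^ n \<le> (1 / 2) ^ N" using n by (intro power_decreasing) auto
    then have "(1 / 2) ^ n \<le> 1 / (16 * L)" using N unfolding \<eta>_def by linarith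
    then have "\<exists>s\<in>{2 * l, 2 * l + 1}. A \<inter> hball (site (level_scale n) i j s) (1 / (16 * L) * level_scale n) = {}"
      using L(1) lip by (intro bilipschitz_misses_hball) blast+
    then obtain s where s: "s = 2 * l \<or> s = 2 * l + 1" "A \<inter> hball (site t i j s) (\<eta> * t) = {}"
      unfolding t_def \<eta>_def by blast
    define H where "H = hball (site t i j s) (\<eta> * t)"
    have \<eta>t: "0 < \<eta> * t" using \<eta> t by simp
    \<comment> \<open>The hole is open, so it survives the passage from the arbitrary set
      \<open>A\<close> to its closure, whose bounded pieces are compact and measurable.\<close>
    have "H \<inter> closure A = {}"
      using s(2) open_Int_closure_eq_empty[OF open_hball[OF \<eta>t]] by (auto simp: H_def)
    then have "B k \<inter> tile t w \<subseteq> tile t w - H" by (auto simp: B_def)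
    then have "emeasure lborel (B k \<inter> tile t w) \<le> emeasure lborel (tile t w - H)"
      using borel_tile borel_hball[OF \<eta>t] by (intro emeasure_mono) (auto simp: H_def)
    also have "\<dots> = emeasure lborel (tile t w) - emeasure lborel H"
      using hball_site_subset_tile[OF t \<eta> s(1)] borel_tile borel_hball[OF \<eta>t] emeasure_hball[OF \<eta>t]
      by (intro emeasure_Diff) (auto simp: H_def w)
    also have "\<dots> = ennreal (c * t ^ 4)"
      unfolding H_def emeasure_hball[OF \<eta>t] emeasure_tile[OF t] using \<eta>t
      by (simp add: ennreal_minus c_def power_mult_distrib algebra_simps)
    finally show "emeasure lborel (B k \<inter> tile (level_scale n) w) \<le> ennreal (c * level_scale n ^ 4)"
      by (simp add: t_def)
  qed
  have cover: "A \<subseteq> (\<Union>k. B k)"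
  proof
    fix p assume "p \<in> A"
    moreover obtain k where "norm p \<le> real k" using real_arch_simple by blast
    ultimately show "p \<in> (\<Union>k. B k)" using closure_subset by (auto simp: B_def)
  qed
  have "hausdorff_premeasure UNIV d_cc 4 \<delta> A = 0" if "0 < \<delta>" for \<delta>
    by (rule hausdorff_premeasure_null_UN[OF _ cover]) (rule hausdorff_premeasure_d_cc_null[OF comp null that])
  then show ?thesis unfolding hausdorff_measure_def by (simp add: SUP_eq_const[of _ _ 0])
qed

theorem theorem1p2:
  shows "\<exists>d :: heis \<Rightarrow> heis \<Rightarrow> real.
    Metric_space UNIV d \<and>
    (\<forall>p q. d p q \<le> d_cc p q) \<and>
    ahlfors_regular UNIV d 4 \<and>
    (\<forall>A :: heis set. hausdorff_measure UNIV d_cc 4 A > 0 \<longrightarrow>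
       \<not> bilipschitz_equivalent_on A d d_cc)"
proof (intro exI[of _ sdist] conjI allI impI notI)
  show "Metric_space UNIV sdist" by (rule Metric_space_sdist)
  show "sdist p q \<le> d_cc p q" for p q
    using sdist_le_hdist[of p q] hdist_le_d_cc[of p q] by linarith
  show "ahlfors_regular UNIV sdist 4" by (rule ahlfors_regular_sdist)
  show False if "0 < hausdorff_measure UNIV d_cc 4 A" "bilipschitz_equivalent_on A sdist d_cc" for A
    using that bilipschitz_hausdorff_measure_zero by simp
qed

end
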